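(* Let $\alpha,\beta,c\in\mathbf{C}$ with $c\neq0$. There is no nontrivial meromorphic solution $f$ on $\mathbf{C}$ of finite order to the difference equation $$f^3(z)+f^3(z+c)=e^{\alpha z+\beta}.$$ That is, if $f$ is a meromorphic function on $\mathbf{C}$ satisfying this equation and $\rho(f)<\infty$, then $f$ is a trivial solution, i.e. $f(z)=de^{\frac{\alpha z+\beta}{3}}$ for some $d\in\mathbf{C}$ with $d^3\left(1+e^{\alpha c}\right)=1$.
   Context: Here $f^3$ denotes the third power of $f$. The trivial solutions of $f^3(z)+f^3(z+c)=e^{\alpha z+\beta}$ are the functions $f(z)=de^{\frac{\alpha z+\beta}{3}}$ with $d\in\mathbf{C}$ and $d^3(1+e^{\alpha c})=1$; a solution is nontrivial if it is not of this form. The order of a meromorphic function $f$ on $\mathbf{C}$ is $$\rho(f):=\limsup_{r\to+\infty}\frac{\log T(r,f)}{\log r},$$ where $T(r,f)$ is the Nevanlinna characteristic function of $f$. *)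

theory Defs
  imports "HOL-Complex_Analysis.Complex_Analysis"
begin

definition log_plus :: "real \<Rightarrow> real" where
  "log_plus x = max 0 (ln x)" \<comment> \<open>\<^term>\<open>log_plus 0 = 0\<close>, because \<^term>\<open>ln 0 = (0::real)\<close>\<close>

text \<open>Nevanlinna theory. All notions below are meant for \<^term>\<open>f meromorphic_on UNIV\<close>.\<close>

definition proximity_function :: "real \<Rightarrow> (complex \<Rightarrow> complex) \<Rightarrow> real" where
  "proximity_function r f =
     1 / (2 * pi) * integral {0..2 * pi} (\<lambda>\<theta>. log_plus (norm (f (of_real r * cis \<theta>))))"

text \<open>At a pole, \<^const>\<open>zorder\<close> is negative and its absolute value is the multiplicity of the pole.\<close>

definition pole_count :: "real \<Rightarrow> (complex \<Rightarrow> complex) \<Rightarrow> nat" where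
  "pole_count t f = (\<Sum>z | norm z \<le> t \<and> is_pole f z. nat (- zorder f z))"

definition integrated_pole_count :: "real \<Rightarrow> (complex \<Rightarrow> complex) \<Rightarrow> real" where
  "integrated_pole_count r f =
     integral {0..r} (\<lambda>t. (real (pole_count t f) - real (pole_count 0 f)) / t)
       + real (pole_count 0 f) * ln r"

definition nevanlinna_characteristic :: "real \<Rightarrow> (complex \<Rightarrow> complex) \<Rightarrow> real" where
  "nevanlinna_characteristic r f = proximity_function r f + integrated_pole_count r f"

text \<open>
  The characteristic can vanish for all large \<open>r\<close> only if \<open>f\<close> is a constant of modulus at most 1;
  the convention \<^term>\<open>ln 0 = (0::real)\<close> then gives such constants order 0, like all others.
\<close>

definition growth_order :: "(complex \<Rightarrow> complex) \<Rightarrow> ereal" where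
  "growth_order f = Limsup at_top (\<lambda>r. ereal (ln (nevanlinna_characteristic r f) / ln r))"

text \<open>
  For meromorphic \<open>f\<close>, the equation is an identity of meromorphic functions. The values taken at
  poles are arbitrary conventions, so it is required only where neither term on the left has a pole.
\<close>

definition solves_fermat_difference_eq ::
    "complex \<Rightarrow> complex \<Rightarrow> complex \<Rightarrow> (complex \<Rightarrow> complex) \<Rightarrow> bool" where
  "solves_fermat_difference_eq \<alpha> \<beta> c f \<longleftrightarrow>
     (\<forall>z. \<not> is_pole f z \<longrightarrow> \<not> is_pole f (z + c) \<longrightarrow>
        f z ^ 3 + f (z + c) ^ 3 = exp (\<alpha> * z + \<beta>))"

definition trivial_solution ::
    "complex \<Rightarrow> complex \<Rightarrow> complex \<Rightarrow> (complex \<Rightarrow> complex) \<Rightarrow> bool" where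
  "trivial_solution \<alpha> \<beta> c f \<longleftrightarrow>
     (\<exists>d. d ^ 3 * (1 + exp (\<alpha> * c)) = 1 \<and> (\<forall>z. f z = d * exp ((\<alpha> * z + \<beta>) / 3)))"

end

theory Submission
  imports Defs
begin

text \<open>
  Put \<open>E(z) = exp ((\<alpha> z + \<beta>) / 3)\<close>, \<open>F = f / E\<close> and \<open>G(z) = f(z + c) / E(z)\<close>. The equation says that
  \<open>(F, G)\<close> maps the plane into the Fermat cubic \<open>x^3 + y^3 = 1\<close>, an elliptic curve. Its invariant
  differential \<open>dx / y^2\<close> pulls back to \<open>u dz\<close> with \<open>u = F' / G^2 = - G' / F^2 = F' G - F G'\<close>, and
  \<open>u\<close> is entire: at a pole of \<open>F\<close> the function \<open>G\<close> has a pole of the same size, so \<open>u\<close> stays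
  bounded. The claim is that finite order forces \<open>u = 0\<close>, because then \<open>F\<close> is constant.

  First, \<open>u\<close> is a polynomial. Let \<open>U\<close> be a primitive of \<open>u\<close>. If \<open>(P, Q, S)\<close> is a holomorphic
  triple without common zeros that represents the map in homogeneous coordinates, then the
  function \<open>ln (|P|^2 + |Q|^2 + |S|^2) - |U|^2 / 3\<close> is subharmonic, since the pulled-back
  Fubini-Study metric of the cubic is at least a third of the flat metric \<open>|u|^2\<close>
  (\<open>fermat_log_norm_mean_value\<close>). On a disc of radius \<open>r\<close> such a triple arises from \<open>(f, f(z + c), E)\<close>
  by multiplying with a Blaschke product that clears the poles of \<open>f\<close>. It has modulus 1 on the
  circle, and its size at the origin is measured by the integrated pole count. The mean value
  inequality therefore bounds the mean of \<open>|U|^2\<close> over the circle by a multiple of the Nevanlinna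
  characteristic of \<open>f\<close> plus a multiple of \<open>1 + r\<close> (\<open>energy_bound\<close>). Finite order makes this a power of
  \<open>r\<close>, and Liouville's theorem applies (\<open>u_polynomial\<close>).

  Second, a polynomial \<open>u\<close> vanishes. Since \<open>G(z) = K F(z + c)\<close> for a constant \<open>K\<close>, the quotient
  \<open>(u(z + c) / u(z))^3\<close> is a rational function of \<open>F(z)^3\<close> (\<open>u_shift\<close>). For a nonzero polynomial the
  quotient tends to 1 at infinity, whereas the rational function is 0 at \<open>F = 0\<close> if \<open>K^3 \<noteq> 1\<close> and
  the constant \<open>- 1\<close> if \<open>K^3 = 1\<close>; so \<open>F\<close> stays away from 0 near infinity (\<open>F_bounded_below_near_infinity\<close>). Then \<open>1 / F\<close>
  and \<open>G / F\<close> are bounded near infinity, Cauchy's inequality makes their derivatives decay, and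
  these derivatives are \<open>- u (G / F)^2\<close> and \<open>- u (1 / F)^2\<close>. Hence \<open>u\<close> tends to 0 at infinity and
  is 0 (\<open>u_eq_0\<close>).
\<close>

section \<open>Mean values of subharmonic functions\<close>

text \<open>
  The functions \<open>a\<close>, \<open>b\<close>, \<open>d\<close> are the Wirtinger derivatives \<open>\<partial>w\<close>, \<open>\<partial>\<partial>w\<close> and \<open>\<partial>\<partial>'w\<close>, where
  \<open>\<partial>'\<close> is the conjugate derivative, so \<open>d\<close> is a quarter of the Laplacian of \<open>w\<close>. The radial
  derivative of the integral of \<open>w\<close> over the circle of radius \<open>t\<close> is \<open>2 Re (J t) / t\<close>, where
  \<open>J t\<close> is the integral of \<open>z a(z)\<close> over that circle. Up to a derivative in the angle, which
  integrates to 0, \<open>t J' t\<close> is the integral of \<open>2 t^2 d\<close>. So \<open>Re J\<close> increases from \<open>J 0 = 0\<close>, and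
  hence the circular means increase from \<open>w 0\<close>.
\<close>

lemma subharmonic_mean_value:
  fixes w :: "complex \<Rightarrow> real" and a b d :: "complex \<Rightarrow> complex"
  assumes r: "r > 0"
    and w': "\<And>z. z \<in> cball 0 r \<Longrightarrow> (w has_derivative (\<lambda>h. 2 * Re (a z * h))) (at z)"
    and a': "\<And>z. z \<in> cball 0 r \<Longrightarrow> (a has_derivative (\<lambda>h. b z * h + d z * cnj h)) (at z)"
    and b: "continuous_on (cball 0 r) b" and d: "continuous_on (cball 0 r) d"
    and pos: "\<And>z. z \<in> cball 0 r \<Longrightarrow> 0 \<le> Re (d z)"
  shows "2 * pi * w 0 \<le> integral {0..2*pi} (\<lambda>\<theta>. w (of_real r * cis \<theta>))"
proof -
  define p where "p = (\<lambda>t \<theta>. complex_of_real t * cis \<theta>)"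
  have p_in: "p t \<theta> \<in> cball 0 r" if "t \<in> {0..r}" for t \<theta>
    using that by (simp add: p_def norm_mult)
  have cont_w: "continuous_on (cball 0 r) w" and cont_a: "continuous_on (cball 0 r) a"
    using w' a' by (meson continuous_at_imp_continuous_on has_derivative_continuous)+
  have p_t: "((\<lambda>t. p t \<theta>) has_derivative (\<lambda>h. of_real h * cis \<theta>)) (at t within S)" for t \<theta> S
    unfolding p_def by (auto intro!: derivative_eq_intros)
  have p_\<theta>: "((\<lambda>\<theta>. p t \<theta>) has_derivative (\<lambda>h. of_real h * (\<i> * p t \<theta>))) (at \<theta> within S)" for t \<theta> S
    unfolding p_def by (auto intro!: derivative_eq_intros simp: fun_eq_iff scaleR_conv_of_real)
  have comp_p: "continuous_on ({0..r} \<times> cbox 0 (2*pi)) (\<lambda>(t, \<theta>). g (p t \<theta>))"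
    if "continuous_on (cball 0 r) g" for g :: "complex \<Rightarrow> 'y::topological_space"
    unfolding case_prod_unfold
    by (rule continuous_on_compose2[OF that])
       (use p_in in \<open>auto simp: p_def intro!: continuous_intros\<close>)
  note cp = comp_p[unfolded case_prod_unfold]
  have sec: "(\<lambda>\<theta>. g (t, \<theta>)) integrable_on cbox 0 (2*pi)"
    if "continuous_on ({0..r} \<times> cbox 0 (2*pi)) g" "t \<in> {0..r}"
    for g :: "real \<times> real \<Rightarrow> 'z::banach" and t
    by (intro integrable_continuous continuous_on_compose2[OF that(1)]) 
       (use that in \<open>auto intro!: continuous_intros\<close>)
  define m where "m = (\<lambda>t. integral (cbox 0 (2*pi)) (\<lambda>\<theta>. w (p t \<theta>)))"
  define J where "J = (\<lambda>t. integral (cbox 0 (2*pi)) (\<lambda>\<theta>. p t \<theta> * a (p t \<theta>)))"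
  define mt where "mt = (\<lambda>t \<theta>. 2 * Re (a (p t \<theta>) * cis \<theta>))"
  define Jt where "Jt = (\<lambda>t \<theta>. cis \<theta> * a (p t \<theta>)
     + p t \<theta> * (b (p t \<theta>) * cis \<theta> + d (p t \<theta>) * cnj (cis \<theta>)))"
  have cmt: "continuous_on ({0..r} \<times> cbox 0 (2*pi)) (\<lambda>(t, \<theta>). mt t \<theta>)"
    unfolding mt_def case_prod_unfold by (intro continuous_intros cp cont_a)
  have cJt: "continuous_on ({0..r} \<times> cbox 0 (2*pi)) (\<lambda>(t, \<theta>). Jt t \<theta>)"
    unfolding Jt_def case_prod_unfold by (intro continuous_intros cp cont_a b d)
  have m_deriv: "(m has_vector_derivative integral (cbox 0 (2*pi)) (mt t)) (at t within {0..r})"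
    if t: "t \<in> {0..r}" for t
    unfolding m_def
  proof (rule leibniz_rule_vector_derivative[OF _ _ cmt t])
    fix t \<theta> assume t: "t \<in> {0..r}"
    show "((\<lambda>t. w (p t \<theta>)) has_vector_derivative mt t \<theta>) (at t within {0..r})"
      unfolding has_vector_derivative_def
      by (rule has_derivative_eq_rhs[OF has_derivative_compose[OF p_t w'[OF p_in[OF t]]]])
         (auto simp: mt_def fun_eq_iff algebra_simps)
  qed (use sec[OF cp[OF cont_w]] in auto)
  have J_deriv: "(J has_vector_derivative integral (cbox 0 (2*pi)) (Jt t)) (at t within {0..r})"
    if t: "t \<in> {0..r}" for t
    unfolding J_def
  proof (rule leibniz_rule_vector_derivative[OF _ _ cJt t])
    fix t \<theta> assume t: "t \<in> {0..r}"
    have *: "((\<lambda>t. a (p t \<theta>)) has_derivative (\<lambda>h. b (p t \<theta>) * (of_real h * cis \<theta>)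
        + d (p t \<theta>) * cnj (of_real h * cis \<theta>))) (at t within {0..r})"
      by (rule has_derivative_compose[OF p_t a'[OF p_in[OF t]]])
    show "((\<lambda>t. p t \<theta> * a (p t \<theta>)) has_vector_derivative Jt t \<theta>) (at t within {0..r})"
      unfolding has_vector_derivative_def
      by (rule has_derivative_eq_rhs[OF has_derivative_mult[OF p_t *]])
         (auto simp: Jt_def fun_eq_iff algebra_simps scaleR_conv_of_real)
  next
    have "continuous_on (cball 0 r) (\<lambda>z. z * a z)" by (intro continuous_intros cont_a)
    from sec[OF cp[OF this]] show "(\<lambda>\<theta>. p t \<theta> * a (p t \<theta>)) integrable_on cbox 0 (2*pi)"
      if "t \<in> {0..r}" for t using that by simp
  qed auto
  have J'_nonneg: "0 \<le> Re (integral (cbox 0 (2*pi)) (Jt t))" if t: "t \<in> {0<..r}" for t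
  proof -
    from t have tr: "t \<in> {0..r}" by auto
    define X where "X = (\<lambda>\<theta>. p t \<theta> * a (p t \<theta>))"
    define X' where "X' = (\<lambda>\<theta>. \<i> * p t \<theta> * a (p t \<theta>) + p t \<theta> *
       (b (p t \<theta>) * (\<i> * p t \<theta>) + d (p t \<theta>) * cnj (\<i> * p t \<theta>)))"
    have *: "((\<lambda>\<theta>. a (p t \<theta>)) has_derivative (\<lambda>h. b (p t \<theta>) * (of_real h * (\<i> * p t \<theta>))
        + d (p t \<theta>) * cnj (of_real h * (\<i> * p t \<theta>)))) (at \<theta> within S)" for \<theta> S
      by (rule has_derivative_compose[OF p_\<theta> a'[OF p_in[OF tr]]])
    have "(X has_vector_derivative X' \<theta>) (at \<theta> within {0..2*pi})" for \<theta>
      unfolding has_vector_derivative_def X_def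
      by (rule has_derivative_eq_rhs[OF has_derivative_mult[OF p_\<theta> *]])
         (auto simp: X'_def fun_eq_iff algebra_simps scaleR_conv_of_real)
    then have "(X' has_integral X (2*pi) - X 0) {0..2*pi}"
      by (intro fundamental_theorem_of_calculus) auto
    also have "X (2*pi) - X 0 = 0"
      by (simp add: X_def p_def)
    finally have X'_int: "(X' has_integral 0) (cbox 0 (2*pi))" by simp
    have dint: "(\<lambda>\<theta>. d (p t \<theta>)) integrable_on cbox 0 (2*pi)"
      using sec[OF cp[OF d] tr] by simp
    \<comment> \<open>the radial and the angular derivative of \<open>z a(z)\<close> differ only in the sign of the conjugate part\<close>
    have eq: "of_real t * Jt t \<theta> = - \<i> * X' \<theta> + of_real (2 * t^2) * d (p t \<theta>)" for \<theta>
    proof -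
      have "cis \<theta> * cnj (cis \<theta>) = 1" by (simp add: cis_cnj cis_mult)
      then show ?thesis
        unfolding Jt_def X'_def p_def by (simp add: algebra_simps power2_eq_square)
    qed
    have "((\<lambda>\<theta>. - \<i> * X' \<theta> + of_real (2 * t^2) * d (p t \<theta>)) has_integral
           - \<i> * 0 + of_real (2 * t^2) * integral (cbox 0 (2*pi)) (\<lambda>\<theta>. d (p t \<theta>))) (cbox 0 (2*pi))"
      by (intro has_integral_add has_integral_mult_right X'_int integrable_integral dint)
    then have "integral (cbox 0 (2*pi)) (\<lambda>\<theta>. of_real t * Jt t \<theta>) =
       of_real (2 * t^2) * integral (cbox 0 (2*pi)) (\<lambda>\<theta>. d (p t \<theta>))"
      unfolding eq by (simp add: integral_unique)
    then have "of_real t * integral (cbox 0 (2*pi)) (Jt t) = 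
       of_real (2 * t^2) * integral (cbox 0 (2*pi)) (\<lambda>\<theta>. d (p t \<theta>))"
      by simp
    then have "t * Re (integral (cbox 0 (2*pi)) (Jt t)) = 
       2 * t^2 * Re (integral (cbox 0 (2*pi)) (\<lambda>\<theta>. d (p t \<theta>)))"
      unfolding complex_eq_iff by simp
    also have "Re (integral (cbox 0 (2*pi)) (\<lambda>\<theta>. d (p t \<theta>))) = integral (cbox 0 (2*pi)) (\<lambda>\<theta>. Re (d (p t \<theta>)))"
      using integral_linear[OF dint bounded_linear_Re] by (simp add: o_def)
    also have "2 * t^2 * \<dots> \<ge> 0"
      using dint pos p_in[OF tr]
      by (intro mult_nonneg_nonneg integral_nonneg) (auto intro!: integrable_linear[OF _ bounded_linear_Re, unfolded o_def])
    finally show ?thesis using t by (simp add: zero_le_mult_iff)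
  qed
  have J_cont: "continuous_on {0..r} J" and m_cont: "continuous_on {0..r} m"
    using continuous_on_vector_derivative[OF J_deriv] continuous_on_vector_derivative[OF m_deriv] by auto
  have interior_at: "at t within {0..r} = at t" if "0 < t" "t < r" for t
    using that by (simp add: at_within_Icc_at)
  have J_nonneg: "0 \<le> Re (J t)" if t: "t \<in> {0..r}" for t
  proof -
    have "Re (J 0) \<le> Re (J t)"
    proof (rule DERIV_nonneg_imp_increasing_open[where f="\<lambda>t. Re (J t)"])
      show "continuous_on {0..t} (\<lambda>t. Re (J t))"
        by (intro continuous_on_Re continuous_on_subset[OF J_cont]) (use t in auto)
      fix x assume x: "0 < x" "x < t"
      have "(J has_vector_derivative integral (cbox 0 (2*pi)) (Jt x)) (at x)"
        using J_deriv[of x] interior_at[of x] x t by simp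
      then have "((\<lambda>t. Re (J t)) has_vector_derivative Re (integral (cbox 0 (2*pi)) (Jt x))) (at x)"
        by (rule bounded_linear.has_vector_derivative[OF bounded_linear_Re])
      then show "\<exists>y. ((\<lambda>t. Re (J t)) has_real_derivative y) (at x) \<and> 0 \<le> y"
        using J'_nonneg[of x] x t by (auto simp: has_real_derivative_iff_has_vector_derivative)
    qed (use t in auto)
    moreover have "J 0 = 0" by (simp add: J_def p_def)
    ultimately show ?thesis by simp
  qed
  have "m 0 \<le> m r"
  proof (rule DERIV_nonneg_imp_increasing_open[where f=m])
    fix x assume x: "0 < x" "x < r"
    have mint: "mt x integrable_on cbox 0 (2*pi)"
      using sec[OF cmt, of x] x by simp
    have "continuous_on (cball 0 r) (\<lambda>z. z * a z)" by (intro continuous_intros cont_a)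
    from sec[OF cp[OF this], of x] x
    have Xint: "(\<lambda>\<theta>. p x \<theta> * a (p x \<theta>)) integrable_on cbox 0 (2*pi)" by simp
    have "x * integral (cbox 0 (2*pi)) (mt x) = integral (cbox 0 (2*pi)) (\<lambda>\<theta>. x * mt x \<theta>)"
      by simp
    also have "(\<lambda>\<theta>. x * mt x \<theta>) = (\<lambda>\<theta>. 2 * Re (p x \<theta> * a (p x \<theta>)))"
      by (simp add: mt_def p_def fun_eq_iff algebra_simps)
    also have "integral (cbox 0 (2*pi)) \<dots> = 2 * integral (cbox 0 (2*pi)) (\<lambda>\<theta>. Re (p x \<theta> * a (p x \<theta>)))"
      by (rule integral_mult_right)
    also have "\<dots> = 2 * Re (J x)"
      unfolding J_def using integral_linear[OF Xint bounded_linear_Re] by (simp only: o_def)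
    finally have "0 \<le> x * integral (cbox 0 (2*pi)) (mt x)"
      using J_nonneg[of x] x by simp
    then have "0 \<le> integral (cbox 0 (2*pi)) (mt x)"
      using x by (simp add: zero_le_mult_iff)
    moreover have "(m has_real_derivative integral (cbox 0 (2*pi)) (mt x)) (at x)"
      using m_deriv[of x] interior_at[of x] x by (simp add: has_real_derivative_iff_has_vector_derivative)
    ultimately show "\<exists>y. (m has_real_derivative y) (at x) \<and> 0 \<le> y" by blast
  qed (use m_cont r in auto)
  then show ?thesis by (simp add: m_def p_def)
qed

section \<open>The logarithmic norm of a curve on the Fermat cubic\<close>

text \<open>
  The three hypotheses on Wronskians say that \<open>u\<close> is the pull-back of the invariant differential
  of the Fermat cubic under the map with homogeneous coordinates \<open>(P, Q, S)\<close>. By Lagrange's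
  identity \<open>\<partial>\<partial>' ln N\<close> is the sum of the squared moduli of the Wronskians divided by \<open>N^2\<close>, that is
  \<open>|u|^2 (|P|^4 + |Q|^4 + |S|^4) / (|P|^2 + |Q|^2 + |S|^2)^2\<close>. By Cauchy-Schwarz this is at least
  \<open>|u|^2 / 3\<close>, and \<open>\<partial>\<partial>' (|U|^2 / 3) = |u|^2 / 3\<close>; hence \<open>w\<close> is subharmonic.
\<close>

lemma fermat_log_norm_mean_value:
  fixes P Q S U u :: "complex \<Rightarrow> complex"
  assumes r: "r > 0"
    and an: "P analytic_on cball 0 r" "Q analytic_on cball 0 r" "S analytic_on cball 0 r"
      "u analytic_on cball 0 r"
    and U: "\<And>z. z \<in> cball 0 r \<Longrightarrow> (U has_field_derivative u z) (at z)"
    and nz: "\<And>z. z \<in> cball 0 r \<Longrightarrow> P z \<noteq> 0 \<or> Q z \<noteq> 0 \<or> S z \<noteq> 0"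
    and W1: "\<And>z. z \<in> cball 0 r \<Longrightarrow> deriv P z * S z - P z * deriv S z = u z * Q z ^ 2"
    and W2: "\<And>z. z \<in> cball 0 r \<Longrightarrow> Q z * deriv S z - deriv Q z * S z = u z * P z ^ 2"
    and W3: "\<And>z. z \<in> cball 0 r \<Longrightarrow> deriv P z * Q z - P z * deriv Q z = u z * S z ^ 2"
  defines "N \<equiv> \<lambda>z. norm (P z) ^ 2 + norm (Q z) ^ 2 + norm (S z) ^ 2"
  defines "w \<equiv> \<lambda>z. ln (N z) - norm (U z) ^ 2 / 3"
  shows "2 * pi * w 0 \<le> integral {0..2*pi} (\<lambda>\<theta>. w (of_real r * cis \<theta>))"
proof -
  define Nc where "Nc = (\<lambda>z. P z * cnj (P z) + Q z * cnj (Q z) + S z * cnj (S z))"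
  define T where "T = (\<lambda>z. deriv P z * cnj (P z) + deriv Q z * cnj (Q z) + deriv S z * cnj (S z))"
  define a where "a = (\<lambda>z. T z / Nc z - u z * cnj (U z) / 3)"
  define b where "b = (\<lambda>z. (deriv (deriv P) z * cnj (P z) + deriv (deriv Q) z * cnj (Q z)
     + deriv (deriv S) z * cnj (S z)) / Nc z - T z * T z / (Nc z * Nc z) - deriv u z * cnj (U z) / 3)"
  define d where "d = (\<lambda>z. (deriv P z * cnj (deriv P z) + deriv Q z * cnj (deriv Q z)
     + deriv S z * cnj (deriv S z)) / Nc z - T z * cnj (T z) / (Nc z * Nc z) - u z * cnj (u z) / 3)"
  have Nc: "Nc z = of_real (N z)" for z
    by (simp add: Nc_def N_def complex_norm_square[symmetric])
  have Npos: "N z > 0" if "z \<in> cball 0 r" for z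
    using nz[OF that] unfolding N_def
    by (metis add_nonneg_nonneg add_nonneg_pos add_pos_nonneg norm_eq_zero zero_le_power2 zero_less_power2)
  have an': "deriv P analytic_on cball 0 r" "deriv Q analytic_on cball 0 r" "deriv S analytic_on cball 0 r"
    "deriv u analytic_on cball 0 r" "deriv (deriv P) analytic_on cball 0 r" 
    "deriv (deriv Q) analytic_on cball 0 r" "deriv (deriv S) analytic_on cball 0 r"
    by (intro analytic_deriv an)+
  have D: "(f has_derivative (\<lambda>h. deriv f z * h)) (at z)"
    if "f analytic_on cball 0 r" "z \<in> cball 0 r" for f z
    using that by (metis analytic_on_imp_differentiable_at DERIV_deriv_iff_field_differentiable has_field_derivative_def)
  have Dc: "((\<lambda>z. cnj (f z)) has_derivative (\<lambda>h. cnj (f' h))) (at z)"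
    if "(f has_derivative f') (at z)" for f f' z
    using bounded_linear.has_derivative[OF bounded_linear_cnj that] .
  have DU: "(U has_derivative (\<lambda>h. u z * h)) (at z)" if "z \<in> cball 0 r" for z
    using U[OF that] by (simp add: has_field_derivative_def)
  have cont: "continuous_on (cball 0 r) f" if "f analytic_on cball 0 r" for f
    using that by (intro holomorphic_on_imp_continuous_on analytic_imp_holomorphic)
  note conts = an[THEN cont] an'[THEN cont]
  have contU: "continuous_on (cball 0 r) U"
    using U by (meson DERIV_isCont continuous_at_imp_continuous_on)
  have DN: "(Nc has_derivative (\<lambda>h. T z * h + cnj (T z) * cnj h)) (at z)" if z: "z \<in> cball 0 r" for z
    unfolding Nc_def
    by (rule has_derivative_eq_rhs, (rule has_derivative_add has_derivative_mult Dc D[OF an(1) z] D[OF an(2) z] D[OF an(3) z])+)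
       (auto simp: T_def fun_eq_iff algebra_simps)
  have DT: "(T has_derivative (\<lambda>h. (deriv (deriv P) z * cnj (P z) + deriv (deriv Q) z * cnj (Q z)
     + deriv (deriv S) z * cnj (S z)) * h + (deriv P z * cnj (deriv P z) + deriv Q z * cnj (deriv Q z)
     + deriv S z * cnj (deriv S z)) * cnj h)) (at z)" if z: "z \<in> cball 0 r" for z
    unfolding T_def
    by (rule has_derivative_eq_rhs, (rule has_derivative_add has_derivative_mult Dc D[OF an(1) z] D[OF an(2) z] D[OF an(3) z] D[OF an'(1) z] D[OF an'(2) z] D[OF an'(3) z])+)
       (auto simp: fun_eq_iff algebra_simps)
  have "2 * pi * w 0 \<le> integral {0..2*pi} (\<lambda>\<theta>. w (of_real r * cis \<theta>))"
  proof (rule subharmonic_mean_value[where a=a and b=b and d=d, OF r])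
    fix z :: complex assume z: "z \<in> cball 0 r"
    have Nz: "Nc z \<noteq> 0" using Npos[OF z] Nc[of z] by simp
    have "((\<lambda>z. Re (Nc z)) has_derivative (\<lambda>h. Re (T z * h + cnj (T z) * cnj h))) (at z)"
      by (rule bounded_linear.has_derivative[OF bounded_linear_Re DN[OF z]])
    then have DNr: "(N has_derivative (\<lambda>h. 2 * Re (T z * h))) (at z)"
      by (simp add: Nc algebra_simps)
    have DUr: "((\<lambda>z. norm (U z) ^ 2) has_derivative (\<lambda>h. 2 * Re (u z * cnj (U z) * h))) (at z)"
    proof -
      have "((\<lambda>z. U z * cnj (U z)) has_derivative (\<lambda>h. U z * cnj (u z * h) + u z * h * cnj (U z))) (at z)"
        by (intro has_derivative_mult Dc DU z)
      from bounded_linear.has_derivative[OF bounded_linear_Re this]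
      show ?thesis
        by (simp add: complex_norm_square[symmetric] del: of_real_power add: algebra_simps)
    qed
    show "(w has_derivative (\<lambda>h. 2 * Re (a z * h))) (at z)"
    proof -
      have "(w has_derivative (\<lambda>h. 2 * Re (T z * h) * inverse (N z) - 2 * Re (u z * cnj (U z) * h) / 3)) (at z)"
        unfolding w_def
        by (rule has_derivative_eq_rhs, (rule has_derivative_diff has_derivative_ln bounded_linear.has_derivative[OF bounded_linear_divide] DNr DUr Npos[OF z])+)
           (auto simp: fun_eq_iff field_simps)
      moreover have "2 * Re (T z * h) * inverse (N z) - 2 * Re (u z * cnj (U z) * h) / 3 = 2 * Re (a z * h)" for h
      proof -
        have "a z * h = T z * h / of_real (N z) - u z * cnj (U z) * h / of_real 3"
          by (simp add: a_def Nc algebra_simps)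
        then show ?thesis
          by (simp only: Re_divide_of_real minus_complex.sel) (simp add: field_simps)
      qed
      ultimately show ?thesis by simp
    qed
    show "(a has_derivative (\<lambda>h. b z * h + d z * cnj h)) (at z)"
      unfolding a_def
      by (rule has_derivative_eq_rhs, (rule has_derivative_diff has_derivative_divide'[OF DT[OF z] DN[OF z] Nz] bounded_linear.has_derivative[OF bounded_linear_divide] has_derivative_mult Dc D[OF an(4) z] DU[OF z])+)
         (use Nz in \<open>auto simp: fun_eq_iff b_def d_def field_simps\<close>)
    show "0 \<le> Re (d z)"
    proof -
      define A where "A = norm (deriv P z) ^ 2 + norm (deriv Q z) ^ 2 + norm (deriv S z) ^ 2"
      have dd: "d z = of_real (A / N z - norm (T z) ^ 2 / (N z * N z) - norm (u z) ^ 2 / 3)"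
        by (simp add: d_def A_def Nc complex_norm_square[symmetric])
      have "of_real (N z * A - norm (T z) ^ 2) = Nc z * (deriv P z * cnj (deriv P z) + deriv Q z * cnj (deriv Q z)
     + deriv S z * cnj (deriv S z)) - T z * cnj (T z)"
        by (simp add: A_def complex_norm_square[symmetric] Nc)
      \<comment> \<open>Lagrange's identity for the vectors \<open>(P, Q, S)\<close> and \<open>(P', Q', S')\<close>\<close>
      also have "\<dots> = (deriv P z * S z - P z * deriv S z) * cnj (deriv P z * S z - P z * deriv S z)
         + (Q z * deriv S z - deriv Q z * S z) * cnj (Q z * deriv S z - deriv Q z * S z)
         + (deriv P z * Q z - P z * deriv Q z) * cnj (deriv P z * Q z - P z * deriv Q z)"
        by (simp add: Nc_def T_def algebra_simps)
      also have "\<dots> = of_real (norm (u z * Q z ^ 2) ^ 2 + norm (u z * P z ^ 2) ^ 2 + norm (u z * S z ^ 2) ^ 2)"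
        unfolding W1[OF z] W2[OF z] W3[OF z] by (simp only: complex_norm_square of_real_add)
      finally have NA: "N z * A - norm (T z) ^ 2 = 
         norm (u z * Q z ^ 2) ^ 2 + norm (u z * P z ^ 2) ^ 2 + norm (u z * S z ^ 2) ^ 2"
        by (simp only: of_real_eq_iff)
      have three: "(x + y + t) ^ 2 \<le> 3 * (x ^ 2 + y ^ 2 + t ^ 2)" for x y t :: real
        using sum_squares_ge_zero[of "x - y" "y - t"] zero_le_power2[of "x - t"]
        by (simp add: power2_eq_square algebra_simps)
      have "norm (u z) ^ 2 * (N z * N z) \<le> norm (u z) ^ 2 * 
         (3 * ((norm (P z) ^ 2)^2 + (norm (Q z) ^ 2)^2 + (norm (S z) ^ 2)^2))"
        using three[of "norm (P z) ^ 2" "norm (Q z) ^ 2" "norm (S z) ^ 2"]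
        by (intro mult_left_mono) (auto simp: N_def power2_eq_square)
      also have "\<dots> = 3 * (N z * A - norm (T z) ^ 2)"
        unfolding NA by (simp add: norm_mult norm_power power_mult_distrib algebra_simps)
      finally have "0 \<le> (3 * (N z * A - norm (T z) ^ 2) - norm (u z) ^ 2 * (N z * N z)) / (3 * (N z * N z))"
        using Npos[OF z] by simp
      also have "\<dots> = A / N z - norm (T z) ^ 2 / (N z * N z) - norm (u z) ^ 2 / 3"
        using Npos[OF z] by (simp add: field_simps)
      finally show ?thesis unfolding dd by simp
    qed
  next
    have Nz: "Nc z \<noteq> 0" if "z \<in> cball 0 r" for z using Npos[OF that] Nc[of z] by simp
    have cN: "continuous_on (cball 0 r) Nc" "continuous_on (cball 0 r) T"
      unfolding Nc_def T_def by (intro continuous_intros conts)+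
    show "continuous_on (cball 0 r) b" "continuous_on (cball 0 r) d"
      unfolding b_def d_def
      using Nz by (auto intro!: continuous_intros cN conts contU)
  qed
  then show ?thesis .
qed

section \<open>Meromorphic parametrisations of the Fermat cubic\<close>

text \<open>
  Riemann's theorem on removable singularities, for a singularity that is already known to be at
  worst a pole.
\<close>

lemma bounded_imp_analytic_remove_sings:
  assumes mero: "h meromorphic_on {z}" and bd: "\<forall>\<^sub>F w in at z. norm (h w) \<le> B"
  shows "remove_sings h analytic_on {z}"
proof -
  have "\<not> is_pole h z"
  proof
    assume "is_pole h z"
    then have "\<forall>\<^sub>F w in at z. B + 1 \<le> norm (h w)"
      by (auto simp: is_pole_def filterlim_at_infinity[of "0::real", simplified] elim!: allE[of _ "max 1 (B+1)"] elim: eventually_mono)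
    with bd have "\<forall>\<^sub>F w in at z. False" by eventually_elim simp
    then show False by simp
  qed
  with mero show ?thesis
    by (meson meromorphic_on_isolated_singularity meromorphic_on_not_essential not_essential_def
        remove_sings_analytic_at)
qed

lemma analytic_eq_at:
  assumes "A analytic_on {z}" "B analytic_on {z}" "\<forall>\<^sub>F w in at z. A w = B w"
  shows "A z = B z"
proof -
  have "B \<midarrow>z\<rightarrow> B z"
    using assms(2) by (auto dest: analytic_at_imp_isCont simp: isCont_def)
  have "A \<midarrow>z\<rightarrow> A z"
    using assms(1) by (auto dest: analytic_at_imp_isCont simp: isCont_def)
  moreover have "A \<midarrow>z\<rightarrow> B z"
    using tendsto_cong[OF assms(3)] \<open>B \<midarrow>z\<rightarrow> B z\<close> by simp
  ultimately show ?thesis by (rule tendsto_unique[OF at_neq_bot])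
qed

lemma eventually_at_eventually_nhds:
  fixes z :: "'a :: t1_space"
  assumes "eventually P (at z)"
  shows "\<forall>\<^sub>F w in at z. eventually P (nhds w)"
proof -
  obtain S where S: "open S" "z \<in> S" "\<And>w. w \<in> S \<Longrightarrow> w \<noteq> z \<Longrightarrow> P w"
    using assms unfolding eventually_at_topological by blast
  have "open (S - {z})" using S(1) by (simp add: open_delete)
  then have "eventually P (nhds w)" if "w \<in> S - {z}" for w
    using S(3) that unfolding eventually_nhds by blast
  then show ?thesis using S unfolding eventually_at_topological by blast
qed

lemma nicely_meromorphic_imp_eventually_not_pole:
  assumes "f nicely_meromorphic_on UNIV"
  shows "\<forall>\<^sub>F w in at z. \<not> is_pole f w"
  using assms meromorphic_on_imp_not_pole_cosparse[of f UNIV] eventually_cosparse_imp_eventually_at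
  by (fastforce simp: nicely_meromorphic_on_def)

lemma finite_poles_in_cball:
  assumes "f meromorphic_on UNIV"
  shows "finite {z. norm z \<le> r \<and> is_pole f z}"
proof -
  have "{z. is_pole f z} sparse_in UNIV"
    using meromorphic_on_imp_not_pole_cosparse[OF assms] by (simp add: eventually_cosparse)
  then have "finite (cball 0 r \<inter> {z. is_pole f z})"
    by (intro sparse_in_compact_finite) (auto intro: sparse_in_subset)
  moreover have "cball 0 r \<inter> {z. is_pole f z} = {z. norm z \<le> r \<and> is_pole f z}"
    by auto
  ultimately show ?thesis by simp
qed

text \<open>
  If \<open>B\<close> were finite at a pole of \<open>A\<close>, then \<open>A^3 = 1 - B^3\<close> would have a finite limit there.
\<close>

lemma pole_transfer_of_fermat:
  assumes "A nicely_meromorphic_on UNIV" "B nicely_meromorphic_on UNIV"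
    and "\<And>z. \<not> is_pole A z \<Longrightarrow> \<not> is_pole B z \<Longrightarrow> A z ^ 3 + B z ^ 3 = 1"
    and "is_pole A z"
  shows "is_pole B z"
proof (rule ccontr)
  assume nB: "\<not> is_pole B z"
  then have "B \<midarrow>z\<rightarrow> B z"
    using assms(2) nicely_meromorphic_on_imp_analytic_at[OF assms(2) _ nB] analytic_at_imp_isCont isContD by blast
  then have "(\<lambda>w. 1 - B w ^ 3) \<midarrow>z\<rightarrow> 1 - B z ^ 3" by (intro tendsto_intros)
  moreover have "\<forall>\<^sub>F w in at z. 1 - B w ^ 3 = A w ^ 3"
    using nicely_meromorphic_imp_eventually_not_pole[OF assms(1), of z]
      nicely_meromorphic_imp_eventually_not_pole[OF assms(2), of z]
    by eventually_elim (use assms(3) in \<open>force simp: algebra_simps\<close>)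
  ultimately have "(\<lambda>w. A w ^ 3) \<midarrow>z\<rightarrow> 1 - B z ^ 3"
    by (rule Lim_transform_eventually)
  moreover have "filterlim (\<lambda>w. A w ^ 3) at_infinity (at z)"
    by (rule Limits.filterlim_power_at_infinity) (use assms(4) in \<open>auto simp: is_pole_def\<close>)
  ultimately show False
    using not_tendsto_and_filterlim_at_infinity[of "at z"] by auto
qed

locale fermat_cubic =
  fixes F G :: "complex \<Rightarrow> complex"
  assumes F: "F nicely_meromorphic_on UNIV" and G: "G nicely_meromorphic_on UNIV"
    and fermat: "\<And>z. \<not> is_pole F z \<Longrightarrow> \<not> is_pole G z \<Longrightarrow> F z ^ 3 + G z ^ 3 = 1"
begin

lemma mero: "F meromorphic_on X" "G meromorphic_on X"
  using F G by (auto simp: nicely_meromorphic_on_def intro: meromorphic_on_subset)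

lemma eventually_regular: "\<forall>\<^sub>F w in at z. \<not> is_pole F w \<and> \<not> is_pole G w"
  using nicely_meromorphic_imp_eventually_not_pole[OF F, of z]
    nicely_meromorphic_imp_eventually_not_pole[OF G, of z] by eventually_elim simp

lemma pole_iff: "is_pole G z \<longleftrightarrow> is_pole F z"
  using pole_transfer_of_fermat[OF F G] pole_transfer_of_fermat[OF G F] fermat by (metis add.commute)

lemma analytic: "\<not> is_pole F z \<Longrightarrow> F analytic_on {z}" "\<not> is_pole F z \<Longrightarrow> G analytic_on {z}"
  using nicely_meromorphic_on_imp_analytic_at[OF F] nicely_meromorphic_on_imp_analytic_at[OF G] pole_iff by auto

text \<open>
  The poles of \<open>F\<close> are also those of \<open>G\<close>, so a point is regular for both functions as soon as it
  is not a pole of \<open>F\<close>.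
\<close>

lemma open_regular: "open {z. \<not> is_pole F z}"
proof -
  have "{z. is_pole F z} sparse_in UNIV"
    using meromorphic_on_imp_not_pole_cosparse[OF mero(1)] by (simp add: eventually_cosparse)
  then have "closed {z. is_pole F z}" by (rule sparse_in_UNIV_imp_closed)
  moreover have "- {z. is_pole F z} = {z. \<not> is_pole F z}" by auto
  ultimately show ?thesis by (metis open_Compl)
qed

lemma derivs:
  assumes "\<not> is_pole F z"
  shows "(F has_field_derivative deriv F z) (at z)" "(G has_field_derivative deriv G z) (at z)"
  using analytic[OF assms] by (auto simp: DERIV_deriv_iff_field_differentiable analytic_on_imp_differentiable_at)

lemma fermat_deriv:
  assumes "\<not> is_pole F z"
  shows "F z ^ 2 * deriv F z + G z ^ 2 * deriv G z = 0"
proof -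
  have "((\<lambda>w. F w ^ 3 + G w ^ 3) has_field_derivative 
     (3 * F z ^ 2 * deriv F z + 3 * G z ^ 2 * deriv G z)) (at z)"
    by (auto intro!: derivative_eq_intros derivs assms)
  moreover have "\<forall>\<^sub>F w in nhds z. F w ^ 3 + G w ^ 3 = 1"
    using eventually_nhds_in_open[OF open_regular, of z] assms
    by (auto elim!: eventually_mono simp: fermat pole_iff)
  then have "((\<lambda>w. F w ^ 3 + G w ^ 3) has_field_derivative 0) (at z)"
    using DERIV_cong_ev[of z z "\<lambda>w. F w ^ 3 + G w ^ 3" "\<lambda>_. 1" 0 0] by simp
  ultimately have "3 * F z ^ 2 * deriv F z + 3 * G z ^ 2 * deriv G z = 0"
    by (rule DERIV_unique)
  then have "3 * (F z ^ 2 * deriv F z + G z ^ 2 * deriv G z) = 0" by (simp add: algebra_simps)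
  then show ?thesis by (simp del: distrib_left_numeral)
qed

text \<open>
  The coefficient of the pulled-back invariant differential \<open>dx / y^2 = - dy / x^2\<close>. The Wronskian
  form avoids dividing by the zeros of \<open>F\<close> and \<open>G\<close>, and \<^const>\<open>remove_sings\<close> fills in the poles.
\<close>

definition u :: "complex \<Rightarrow> complex" where
  "u = remove_sings (\<lambda>z. deriv F z * G z - F z * deriv G z)"

lemma u_regular:
  assumes "\<not> is_pole F z"
  shows "u z = deriv F z * G z - F z * deriv G z"
  unfolding u_def by (intro remove_sings_at_analytic analytic_intros analytic analytic_deriv assms)

lemma u_eqs:
  assumes "\<not> is_pole F z"
  shows "deriv F z = u z * G z ^ 2" "deriv G z = - u z * F z ^ 2"
proof -
  have 1: "F z ^ 3 + G z ^ 3 = 1" and 2: "F z ^ 2 * deriv F z + G z ^ 2 * deriv G z = 0"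
    using fermat fermat_deriv pole_iff assms by auto
  have "u z * G z ^ 2 = deriv F z * (F z ^ 3 + G z ^ 3) - F z * (F z ^ 2 * deriv F z + G z ^ 2 * deriv G z)"
    by (simp add: u_regular[OF assms] power2_eq_square power3_eq_cube algebra_simps)
  then show "deriv F z = u z * G z ^ 2" using 1 2 by simp
  have "- u z * F z ^ 2 = deriv G z * (F z ^ 3 + G z ^ 3) - G z * (F z ^ 2 * deriv F z + G z ^ 2 * deriv G z)"
    by (simp add: u_regular[OF assms] power2_eq_square power3_eq_cube algebra_simps)
  then show "deriv G z = - u z * F z ^ 2" using 1 2 by simp
qed

text \<open>
  Near a pole of \<open>F\<close> put \<open>H = 1 / F\<close>, which is holomorphic there. Since \<open>F^3 + G^3 = 1\<close>, the ratio
  \<open>F / G\<close> is bounded near the pole, and \<open>u = F' / G^2 = - H' (F / G)^2\<close> is bounded as well.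
\<close>

lemma u_analytic: "u analytic_on X"
proof -
  have "u analytic_on {z}" for z
  proof (cases "is_pole F z")
    case False
    then show ?thesis unfolding u_def by (intro remove_sings_analytic_on analytic_intros analytic analytic_deriv)
  next
    case pole: True
    define H where "H = (\<lambda>w. inverse (F w))"
    have Hn: "H nicely_meromorphic_on UNIV"
      unfolding H_def by (intro nicely_meromorphic_on_inverse F)
    have "\<not> is_pole H z"
      unfolding H_def is_pole_inverse_iff using pole
      by (auto simp: isolated_zero_def is_pole_def dest: not_tendsto_and_filterlim_at_infinity[OF at_neq_bot])
    then have "H analytic_on {z}"
      using nicely_meromorphic_on_imp_analytic_at[OF Hn] by simp
    then have "isCont (deriv H) z"
      by (intro analytic_at_imp_isCont analytic_deriv)
    then have "\<forall>\<^sub>F w in at z. norm (deriv H w) < norm (deriv H z) + 1"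
      unfolding isCont_def by (intro order_tendstoD(2)[OF tendsto_norm]) auto
    moreover have "\<forall>\<^sub>F w in at z. 2 \<le> norm (F w)"
      using pole by (auto simp: is_pole_def filterlim_at_infinity[of "0::real", simplified])
    ultimately have "\<forall>\<^sub>F w in at z. norm (deriv F w * G w - F w * deriv G w) \<le> 4 * (norm (deriv H z) + 1)"
      using eventually_regular[of z]
    proof eventually_elim
      case (elim w)
      then have reg: "\<not> is_pole F w" and F0: "F w \<noteq> 0" by auto
      have "(H has_field_derivative - deriv F w / F w ^ 2) (at w)"
        unfolding H_def using derivs[OF reg] F0 by (auto intro!: derivative_eq_intros simp: power2_eq_square field_simps)
      then have H': "norm (deriv H w) = norm (u w) * norm (G w) ^ 2 / norm (F w) ^ 2"
        using u_eqs(1)[OF reg] by (simp add: DERIV_imp_deriv norm_mult norm_divide norm_power)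
      have "norm (F w) ^ 3 = norm (1 - G w ^ 3)"
        using fermat[of w] elim by (simp flip: norm_power add: algebra_simps) (metis add_diff_cancel_right')
      also have "\<dots> \<le> 1 + norm (G w) ^ 3" 
        by (metis norm_one norm_power norm_triangle_ineq4)
      finally have FG: "norm (F w) ^ 3 \<le> 1 + norm (G w) ^ 3" .
      have "norm (F w) \<le> 2 * norm (G w)"
      proof (rule ccontr)
        assume *: "\<not> norm (F w) \<le> 2 * norm (G w)"
        have "norm (G w) ^ 3 \<le> (norm (F w) / 2) ^ 3"
          by (rule power_mono) (use * in auto)
        then have "norm (F w) ^ 3 * 7 \<le> 8" using FG by (simp add: power_divide)
        moreover have "(2::real) ^ 3 \<le> norm (F w) ^ 3"
          by (rule power_mono) (use elim in auto)
        ultimately show False by simp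
      qed
      then have "norm (F w) ^ 2 \<le> (2 * norm (G w)) ^ 2" by (rule power_mono) auto
      then have "norm (u w) * norm (F w) ^ 2 \<le> norm (u w) * (4 * norm (G w) ^ 2)"
        by (intro mult_left_mono) (auto simp: power_mult_distrib)
      then have "norm (u w) \<le> 4 * norm (deriv H w)"
        unfolding H' using F0 by (simp add: field_simps)
      then show ?case using elim u_regular[OF reg] by simp
    qed
    then show ?thesis
      unfolding u_def
      by (intro bounded_imp_analytic_remove_sings meromorphic_intros mero) auto
  qed
  then show ?thesis
    using analytic_on_analytic_at by blast
qed

text \<open>
  If all three of \<open>F\<close>, \<open>G\<close>, 1 are multiplied by \<open>\<Lambda>\<close>, then every Wronskian is multiplied by
  \<open>\<Lambda>^2\<close>, so the products satisfy the Wronskian relations with the same \<open>u\<close>. At the poles of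
  \<open>F\<close> the relations hold by continuity.
\<close>

lemma energy_mean_value:
  fixes P Q \<Lambda> U :: "complex \<Rightarrow> complex"
  assumes r: "r > 0"
    and an: "P analytic_on cball 0 r" "Q analytic_on cball 0 r" "\<Lambda> analytic_on cball 0 r"
    and P: "\<And>z. z \<in> cball 0 r \<Longrightarrow> \<forall>\<^sub>F w in at z. P w = F w * \<Lambda> w"
    and Q: "\<And>z. z \<in> cball 0 r \<Longrightarrow> \<forall>\<^sub>F w in at z. Q w = G w * \<Lambda> w"
    and U: "\<And>z. (U has_field_derivative u z) (at z)"
    and nz: "\<And>z. z \<in> cball 0 r \<Longrightarrow> P z \<noteq> 0 \<or> Q z \<noteq> 0 \<or> \<Lambda> z \<noteq> 0"
  defines "N \<equiv> \<lambda>z. norm (P z) ^ 2 + norm (Q z) ^ 2 + norm (\<Lambda> z) ^ 2"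
  defines "w \<equiv> \<lambda>z. ln (N z) - norm (U z) ^ 2 / 3"
  shows "2 * pi * w 0 \<le> integral {0..2*pi} (\<lambda>\<theta>. w (of_real r * cis \<theta>))"
proof -
  have "deriv P z * \<Lambda> z - P z * deriv \<Lambda> z = u z * Q z ^ 2 \<and>
     Q z * deriv \<Lambda> z - deriv Q z * \<Lambda> z = u z * P z ^ 2 \<and>
     deriv P z * Q z - P z * deriv Q z = u z * \<Lambda> z ^ 2" if z: "z \<in> cball 0 r" for z
  proof -
    have anz: "P analytic_on {z}" "Q analytic_on {z}" "\<Lambda> analytic_on {z}"
      using an z by (auto intro: analytic_on_subset)
    have "\<forall>\<^sub>F w in at z. \<Lambda> analytic_on {w}"
      using anz(3) analytic_on_imp_meromorphic_on eventually_cosparse_imp_eventually_at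
        meromorphic_on_imp_analytic_cosparse by blast
    moreover have "\<forall>\<^sub>F w in at z. \<forall>\<^sub>F v in nhds w. P v = F v * \<Lambda> v"
      using P[OF z] by (rule eventually_at_eventually_nhds)
    moreover have "\<forall>\<^sub>F w in at z. \<forall>\<^sub>F v in nhds w. Q v = G v * \<Lambda> v"
      using Q[OF z] by (rule eventually_at_eventually_nhds)
    ultimately have "\<forall>\<^sub>F w in at z. deriv P w * \<Lambda> w - P w * deriv \<Lambda> w = u w * Q w ^ 2 \<and>
     Q w * deriv \<Lambda> w - deriv Q w * \<Lambda> w = u w * P w ^ 2 \<and>
     deriv P w * Q w - P w * deriv Q w = u w * \<Lambda> w ^ 2"
      using eventually_regular[of z]
    proof eventually_elim
      case (elim w)
      then have reg: "\<not> is_pole F w" by simp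
      have L: "(\<Lambda> has_field_derivative deriv \<Lambda> w) (at w)"
        using elim(1) by (simp add: DERIV_deriv_iff_field_differentiable analytic_on_imp_differentiable_at)
      have "deriv P w = deriv (\<lambda>v. F v * \<Lambda> v) w" "deriv Q w = deriv (\<lambda>v. G v * \<Lambda> v) w"
        using elim by (auto intro: deriv_cong_ev)
      moreover have "deriv (\<lambda>v. F v * \<Lambda> v) w = deriv F w * \<Lambda> w + F w * deriv \<Lambda> w"
        "deriv (\<lambda>v. G v * \<Lambda> v) w = deriv G w * \<Lambda> w + G w * deriv \<Lambda> w"
        using derivs[OF reg] L by (auto intro!: DERIV_imp_deriv derivative_eq_intros)
      moreover have "P w = F w * \<Lambda> w" "Q w = G w * \<Lambda> w"
        using elim eventually_nhds_x_imp_x by blast+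
      ultimately have
        "deriv P w * \<Lambda> w - P w * deriv \<Lambda> w = deriv F w * \<Lambda> w ^ 2"
        "Q w * deriv \<Lambda> w - deriv Q w * \<Lambda> w = - deriv G w * \<Lambda> w ^ 2"
        "deriv P w * Q w - P w * deriv Q w = u w * \<Lambda> w ^ 2"
        and PQ: "P w = F w * \<Lambda> w" "Q w = G w * \<Lambda> w"
        by (simp_all add: u_regular[OF reg] power2_eq_square algebra_simps)
      then show ?case
        by (simp add: u_eqs[OF reg] power_mult_distrib)
    qed
    then have ev: "\<forall>\<^sub>F w in at z. deriv P w * \<Lambda> w - P w * deriv \<Lambda> w = u w * Q w ^ 2"
     "\<forall>\<^sub>F w in at z. Q w * deriv \<Lambda> w - deriv Q w * \<Lambda> w = u w * P w ^ 2"
     "\<forall>\<^sub>F w in at z. deriv P w * Q w - P w * deriv Q w = u w * \<Lambda> w ^ 2"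
      by (auto elim: eventually_mono)
    show ?thesis
      by (intro conjI analytic_eq_at[OF _ _ ev(1)] analytic_eq_at[OF _ _ ev(2)] analytic_eq_at[OF _ _ ev(3)]
            analytic_intros analytic_deriv anz u_analytic)
  qed
  then show ?thesis
    unfolding w_def N_def
    by (intro fermat_log_norm_mean_value[where u=u] r an u_analytic U nz) auto
qed

end

section \<open>Clearing poles and the energy bound\<close>

text \<open>
  The pole count is a step function with a jump at the modulus of each pole, and the integral of
  \<open>1 / t\<close> from \<open>|a|\<close> to \<open>r\<close> is \<open>ln (r / |a|)\<close>.
\<close>

lemma integrated_pole_count_eq:
  assumes f: "f meromorphic_on UNIV" and r: "r > 0"
  defines "A \<equiv> {z. norm z \<le> r \<and> is_pole f z}"
  shows "integrated_pole_count r f =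
    (\<Sum>a\<in>A - {0}. real (nat (- zorder f a)) * ln (r / norm a)) + real (pole_count 0 f) * ln r"
proof -
  define m where "m = (\<lambda>a. nat (- zorder f a))"
  have fin: "finite A" unfolding A_def by (rule finite_poles_in_cball[OF f])
  have cnt: "pole_count t f = (\<Sum>a\<in>A. if norm a \<le> t then m a else 0)" if "t \<in> {0..r}" for t
  proof -
    have "{z. norm z \<le> t \<and> is_pole f z} = {a\<in>A. norm a \<le> t}"
      using that by (auto simp: A_def)
    then show ?thesis
      unfolding pole_count_def m_def by (simp add: sum.inter_filter[OF fin])
  qed
  have rcnt: "real (pole_count t f) = (\<Sum>a\<in>A. if norm a \<le> t then real (m a) else 0)" if "t \<in> {0..r}" for t
    unfolding cnt[OF that] of_nat_sum by (intro sum.cong) auto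
  have diff: "real (pole_count t f) - real (pole_count 0 f) =
      (\<Sum>a\<in>A - {0}. if norm a \<le> t then real (m a) else 0)" if t: "t \<in> {0..r}" for t
  proof -
    have "real (pole_count t f) - real (pole_count 0 f) =
       (\<Sum>a\<in>A. (if norm a \<le> t then real (m a) else 0) - (if norm a \<le> 0 then real (m a) else 0))"
      using rcnt[OF t] rcnt[of 0] r by (simp only: sum_subtractf) simp
    also have "\<dots> = (\<Sum>a\<in>A - {0}. if norm a \<le> t then real (m a) else 0)"
      using t by (intro sum.mono_neutral_cong_right fin) auto
    finally show ?thesis .
  qed
  have one: "((\<lambda>t. (if norm a \<le> t then real (m a) else 0) / t) has_integral real (m a) * ln (r / norm a)) {0..r}"
    if a: "a \<in> A - {0}" for a
  proof -
    have ar: "0 < norm a" "norm a \<le> r" using a by (auto simp: A_def)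
    have "((\<lambda>t. real (m a) / t) has_integral real (m a) * ln r - real (m a) * ln (norm a)) {norm a..r}"
      using ar(2) by (intro fundamental_theorem_of_calculus)
        (auto intro!: derivative_eq_intros dest: less_le_trans[OF ar(1)]
           simp flip: has_real_derivative_iff_has_vector_derivative)
    then have "((\<lambda>t. if t \<in> {norm a..r} then real (m a) / t else 0) has_integral
        real (m a) * ln r - real (m a) * ln (norm a)) {0..r}"
      using ar by (subst has_integral_restrict) auto
    moreover have "real (m a) * ln r - real (m a) * ln (norm a) = real (m a) * ln (r / norm a)"
      using ar r by (simp add: ln_div right_diff_distrib)
    ultimately show ?thesis
      by (auto elim!: has_integral_eq[rotated])
  qed
  have "((\<lambda>t. \<Sum>a\<in>A - {0}. (if norm a \<le> t then real (m a) else 0) / t) has_integral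
     (\<Sum>a\<in>A - {0}. real (m a) * ln (r / norm a))) {0..r}"
    by (intro has_integral_sum one) (use fin in auto)
  then have "((\<lambda>t. (real (pole_count t f) - real (pole_count 0 f)) / t) has_integral
     (\<Sum>a\<in>A - {0}. real (m a) * ln (r / norm a))) {0..r}"
    by (rule has_integral_eq[rotated]) (simp add: diff sum_divide_distrib)
  then show ?thesis
    by (simp add: integrated_pole_count_def m_def integral_unique)
qed

text \<open>
  The Blaschke factor of the disc of radius \<open>r\<close>: it vanishes exactly at \<open>a\<close> and has modulus 1 on
  the boundary circle.
\<close>

definition blaschke :: "real \<Rightarrow> complex \<Rightarrow> complex \<Rightarrow> complex" where
  "blaschke r a z = of_real r * (z - a) / (of_real (r^2) - cnj a * z)"

lemma blaschke_denominator_nonzero: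
  assumes "norm a < r" "z \<in> cball 0 r"
  shows "of_real (r^2) - cnj a * z \<noteq> 0"
proof
  assume "of_real (r^2) - cnj a * z = 0"
  then have "norm (cnj a * z) = r^2"
    by (metis norm_of_real abs_power2 eq_iff_diff_eq_0)
  moreover have "norm (cnj a * z) \<le> norm a * r"
    using assms by (simp add: norm_mult mult_left_mono)
  moreover have "norm a * r < r^2"
    using assms by (simp add: power2_eq_square) (metis mult_strict_right_mono norm_ge_zero order.strict_trans1)
  ultimately show False by simp
qed

lemma analytic_blaschke:
  assumes "norm a < r" "z \<in> cball 0 r"
  shows "blaschke r a analytic_on {z}"
  unfolding blaschke_def using blaschke_denominator_nonzero[OF assms]
  by (intro analytic_intros) auto

lemma blaschke_eq_0_iff:
  assumes "norm a < r" "z \<in> cball 0 r"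
  shows "blaschke r a z = 0 \<longleftrightarrow> z = a"
  using blaschke_denominator_nonzero[OF assms] assms by (auto simp: blaschke_def)

lemma norm_blaschke_circle:
  assumes "norm a < r" "norm z = r"
  shows "norm (blaschke r a z) = 1"
proof -
  \<comment> \<open>on the circle \<open>r^2 = z cnj z\<close>\<close>
  have "of_real (r^2) - cnj a * z = z * cnj (z - a)"
    using assms complex_norm_square[of z] by (simp add: algebra_simps)
  then have "norm (of_real (r^2) - cnj a * z) = r * norm (z - a)"
    by (metis assms(2) complex_mod_cnj norm_mult)
  moreover have "r > 0" "z \<noteq> a" using assms by (auto intro: le_less_trans[OF norm_ge_zero])
  ultimately show ?thesis by (simp add: blaschke_def norm_divide norm_mult)
qed

context fermat_cubic
begin

text \<open>
  A form of the first main theorem of Nevanlinna theory: as the Laplacian of \<open>|U|^2\<close> is \<open>4 |u|^2\<close>,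
  the mean of \<open>|U|^2\<close> over a circle measures the area of the image on the elliptic curve. For the poles \<open>a\<close> of \<open>f\<close> in the disc, with orders
  \<open>m a\<close>, let \<open>R\<close> be the product of the Blaschke factors to the powers \<open>m a\<close>. Then
  \<open>(f R, E G R, E R)\<close> is holomorphic on the closed disc without common zeros. On the circle \<open>|R| = 1\<close>, so
  the logarithm of the norm of the triple is controlled by the proximity function. At the origin
  \<open>|R|\<close> is the exponential of minus the integrated pole count, up to the leading coefficient of
  \<open>f\<close> and a power of \<open>r\<close> if \<open>f\<close> has a pole there. The mean value inequality for this triple is
  the claim. Only circles without poles are considered, which keeps all integrands continuous.
\<close>

lemma energy_bound:
  fixes E U :: "complex \<Rightarrow> complex"
  assumes E: "E holomorphic_on UNIV" "\<And>z. E z \<noteq> 0" "\<And>z. norm (E z) \<le> exp (\<kappa> * (1 + norm z))"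
    and \<kappa>: "\<kappa> \<ge> 0"
    and U: "\<And>z. (U has_field_derivative u z) (at z)" "U 0 = 0"
  defines "f \<equiv> \<lambda>z. F z * E z"
  shows "\<exists>C. \<forall>r>0. (\<forall>z. norm z = r \<longrightarrow> \<not> is_pole f z) \<longrightarrow>
     integral {0..2*pi} (\<lambda>\<theta>. norm (U (of_real r * cis \<theta>)) ^ 2) 
       \<le> 12 * pi * nevanlinna_characteristic r f + C * (1 + r)"
proof -
  define m where "m = (\<lambda>a. nat (- zorder f a))"
  have Ean: "E analytic_on {z}" for z
    using holomorphic_on_imp_analytic_at[OF E(1) open_UNIV] by simp
  have pole_f: "is_pole f z \<longleftrightarrow> is_pole F z" for z
    unfolding f_def by (rule is_pole_mult_analytic_nonzero2_iff[OF Ean E(2)])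
  have fmero: "f meromorphic_on X" for X
  proof -
    have "E analytic_on X" using Ean analytic_on_analytic_at by blast
    then show ?thesis
      unfolding f_def by (intro meromorphic_on_mult mero analytic_on_imp_meromorphic_on)
  qed
  \<comment> \<open>the contribution of the origin: the leading coefficient of \<open>f\<close> at a pole, and \<open>E 0\<close> otherwise\<close>
  define c0 where "c0 = ln (if is_pole f 0 then norm (zor_poly f 0 0) else norm (E 0))"
  have zor: "zor_poly f a a \<noteq> 0 \<and> (\<lambda>w. f w * (w - a) ^ m a) \<midarrow>a\<rightarrow> zor_poly f a a" if "is_pole f a" for a
  proof -
    have iso: "isolated_singularity_at f a"
      by (rule meromorphic_on_isolated_singularity[OF fmero])
    have ness: "not_essential f a" using that by blast
    have fr: "\<exists>\<^sub>F w in at a. f w \<noteq> 0"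
      using non_zero_neighbour_pole[OF that] by (rule eventually_frequently[OF at_neq_bot])
    obtain e where e: "e > 0" "zor_poly f a a \<noteq> 0" "zor_poly f a holomorphic_on cball a e"
      using zorder_exist[OF iso ness fr] by blast
    have "zor_poly f a analytic_on {a}"
      using holomorphic_on_imp_analytic_at[OF holomorphic_on_subset[OF e(3) ball_subset_cball] open_ball] e(1) by simp
    then have "zor_poly f a \<midarrow>a\<rightarrow> zor_poly f a a"
      by (rule isContD[OF analytic_at_imp_isCont])
    then have "(\<lambda>w. f w * (w - a) ^ m a) \<midarrow>a\<rightarrow> zor_poly f a a"
      unfolding m_def by (rule Lim_transform_eventually[OF _ zor_poly_pole_eq[OF iso that]])
    with e(2) show ?thesis by simp
  qed
  have main: "integral {0..2*pi} (\<lambda>\<theta>. norm (U (of_real r * cis \<theta>)) ^ 2) 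
       \<le> 12 * pi * nevanlinna_characteristic r f + 12 * pi * \<kappa> * (1 + r) + 6 * pi * ln 6 - 12 * pi * c0"
    if r: "r > 0" and npc: "\<And>z. norm z = r \<Longrightarrow> \<not> is_pole f z" for r
  proof -
    define A where "A = {z. norm z \<le> r \<and> is_pole f z}"
    have fin: "finite A" unfolding A_def by (rule finite_poles_in_cball[OF fmero])
    have A: "norm a < r" "is_pole f a" if "a \<in> A" for a
      using that npc[of a] by (auto simp: A_def order.strict_iff_order)
    define R where "R = (\<lambda>z. \<Prod>a\<in>A. blaschke r a z ^ m a)"
    define \<Lambda> where "\<Lambda> = (\<lambda>z. E z * R z)"
    define P where "P = remove_sings (\<lambda>z. F z * \<Lambda> z)"
    define Q where "Q = remove_sings (\<lambda>z. G z * \<Lambda> z)"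
    have R_an: "R analytic_on {z}" if "z \<in> cball 0 r" for z
      unfolding R_def by (intro analytic_intros analytic_blaschke A that)
    have \<Lambda>_an: "\<Lambda> analytic_on {z}" if "z \<in> cball 0 r" for z
      unfolding \<Lambda>_def by (intro analytic_intros R_an Ean that)
    have \<Lambda>_nz: "\<Lambda> z \<noteq> 0" if "z \<in> cball 0 r" "\<not> is_pole f z" for z
      using that E(2) fin A by (auto simp: \<Lambda>_def R_def blaschke_eq_0_iff)
    have reg: "P analytic_on {z} \<and> Q analytic_on {z} \<and> P z = F z * \<Lambda> z \<and> Q z = G z * \<Lambda> z"
      if z: "z \<in> cball 0 r" "\<not> is_pole f z" for z
    proof -
      have "(\<lambda>z. F z * \<Lambda> z) analytic_on {z}" "(\<lambda>z. G z * \<Lambda> z) analytic_on {z}"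
        using z pole_f by (auto intro!: analytic_intros analytic \<Lambda>_an)
      then show ?thesis unfolding P_def Q_def by (auto intro: remove_sings_analytic_on)
    qed
    \<comment> \<open>\<open>K a\<close> is \<open>R\<close> without its zero at \<open>a\<close>\<close>
    define K where "K = (\<lambda>a z. (of_real r / (of_real (r^2) - cnj a * z)) ^ m a * 
       (\<Prod>b\<in>A - {a}. blaschke r b z ^ m b))"
    have limP: "(\<lambda>z. F z * \<Lambda> z) \<midarrow>a\<rightarrow> zor_poly f a a * K a a" if a: "a \<in> A" for a
    proof -
      have acb: "a \<in> cball 0 r" using A[OF a] by simp
      have "K a analytic_on {a}"
        unfolding K_def using blaschke_denominator_nonzero[OF A(1)[OF a] acb]
        by (intro analytic_intros analytic_blaschke A acb) auto
      then have "K a \<midarrow>a\<rightarrow> K a a" by (rule isContD[OF analytic_at_imp_isCont])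
      then have "(\<lambda>w. (f w * (w - a) ^ m a) * K a w) \<midarrow>a\<rightarrow> zor_poly f a a * K a a"
        using zor[OF A(2)[OF a]] by (intro tendsto_mult) auto
      moreover have "f w * (w - a) ^ m a * K a w = F w * \<Lambda> w" for w
      proof -
        have "R w = blaschke r a w ^ m a * (\<Prod>b\<in>A - {a}. blaschke r b w ^ m b)"
          unfolding R_def by (rule prod.remove[OF fin a])
        also have "blaschke r a w = (w - a) * (of_real r / (of_real (r^2) - cnj a * w))"
          by (simp add: blaschke_def)
        finally show ?thesis
          unfolding \<Lambda>_def f_def K_def by (simp only: power_mult_distrib mult_ac)
      qed
      ultimately show ?thesis by simp
    qed
    have Knz: "K a a \<noteq> 0" if a: "a \<in> A" for a
    proof -
      have acb: "a \<in> cball 0 r" using A[OF a] by simp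
      show ?thesis
        using blaschke_denominator_nonzero[OF A(1)[OF a] acb] r fin A acb
        by (auto simp: K_def blaschke_eq_0_iff)
    qed
    have \<Lambda>_mero: "\<Lambda> meromorphic_on {z}" if "z \<in> cball 0 r" for z
      by (rule analytic_on_imp_meromorphic_on[OF \<Lambda>_an[OF that]])
    have pole: "P analytic_on {a} \<and> Q analytic_on {a} \<and> P a = zor_poly f a a * K a a" if a: "a \<in> A" for a
    proof -
      have acb: "a \<in> cball 0 r" using A[OF a] by simp
      have 1: "P analytic_on {a}"
        unfolding P_def by (rule remove_sings_analytic_at[OF _ limP[OF a]])
          (intro meromorphic_on_isolated_singularity meromorphic_intros mero \<Lambda>_mero acb)
      have 2: "P a = zor_poly f a a * K a a"
        unfolding P_def using limP[OF a] by (rule remove_sings_eqI)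
      have "\<Lambda> \<midarrow>a\<rightarrow> \<Lambda> a" using \<Lambda>_an[OF acb] by (rule isContD[OF analytic_at_imp_isCont])
      then have ev1: "\<forall>\<^sub>F w in at a. norm (\<Lambda> w) < norm (\<Lambda> a) + 1"
        by (intro order_tendstoD(2)[OF tendsto_norm]) auto
      have ev2: "\<forall>\<^sub>F w in at a. norm (F w * \<Lambda> w) < norm (zor_poly f a a * K a a) + 1"
        using limP[OF a] by (intro order_tendstoD(2)[OF tendsto_norm]) auto
      define B where "B = norm (\<Lambda> a) + 1 + (norm (zor_poly f a a * K a a) + 1)"
      \<comment> \<open>the equation bounds \<open>G \<Lambda>\<close> by \<open>\<Lambda>\<close> and \<open>F \<Lambda>\<close>\<close>
      have "\<forall>\<^sub>F w in at a. norm (G w * \<Lambda> w) \<le> B"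
        using ev1 ev2 eventually_regular[of a]
      proof eventually_elim
        case (elim w)
        have "(G w * \<Lambda> w) ^ 3 = \<Lambda> w ^ 3 - (F w * \<Lambda> w) ^ 3"
          using fermat[of w] elim by (simp add: power_mult_distrib) (metis add_diff_cancel_left' left_diff_distrib mult_1)
        then have "norm (G w * \<Lambda> w) ^ 3 \<le> norm (\<Lambda> w) ^ 3 + norm (F w * \<Lambda> w) ^ 3"
          by (metis norm_power norm_triangle_ineq4)
        also have "\<dots> \<le> (norm (\<Lambda> w) + norm (F w * \<Lambda> w)) ^ 3"
          by (simp add: power3_eq_cube algebra_simps)
        also have "\<dots> \<le> B ^ 3"
          by (rule power_mono) (use elim in \<open>auto simp: B_def\<close>)
        finally show ?case
          by (rule power_mono_iff[THEN iffD1, rotated -1]) (simp_all add: B_def)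
      qed
      then have 3: "Q analytic_on {a}"
        unfolding Q_def by (intro bounded_imp_analytic_remove_sings meromorphic_intros mero \<Lambda>_mero acb)
      from 1 2 3 show ?thesis by blast
    qed
    have cases: "z \<in> A \<or> \<not> is_pole f z" if "z \<in> cball 0 r" for z
      using that by (auto simp: A_def)
    define w where "w = (\<lambda>z. ln (norm (P z) ^ 2 + norm (Q z) ^ 2 + norm (\<Lambda> z) ^ 2) - norm (U z) ^ 2 / 3)"
    have sub: "2 * pi * w 0 \<le> integral {0..2*pi} (\<lambda>\<theta>. w (of_real r * cis \<theta>))"
      unfolding w_def
    proof (rule energy_mean_value[OF r _ _ _ _ _ U(1)])
      show "P analytic_on cball 0 r" "Q analytic_on cball 0 r" "\<Lambda> analytic_on cball 0 r"
        using cases pole reg \<Lambda>_an by (meson analytic_on_analytic_at)+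
      fix z :: complex assume z: "z \<in> cball 0 r"
      show "\<forall>\<^sub>F w in at z. P w = F w * \<Lambda> w" "\<forall>\<^sub>F w in at z. Q w = G w * \<Lambda> w"
        unfolding P_def Q_def 
        by (intro eventually_remove_sings_eq_at meromorphic_on_isolated_singularity meromorphic_intros mero \<Lambda>_mero z)+
      show "P z \<noteq> 0 \<or> Q z \<noteq> 0 \<or> \<Lambda> z \<noteq> 0"
        using cases[OF z] pole[of z] Knz[of z] zor[of z] A(2)[of z] \<Lambda>_nz[OF z] by auto
    qed
    have lnprod: "ln (norm (\<Prod>b\<in>A - {0}. blaschke r b 0 ^ m b)) = - (\<Sum>a\<in>A - {0}. real (m a) * ln (r / norm a))"
      "norm (\<Prod>b\<in>A - {0}. blaschke r b 0 ^ m b) > 0"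
    proof -
      have b0: "norm (blaschke r b 0) = norm b / r" for b
        using r by (simp add: blaschke_def norm_divide norm_mult power2_eq_square)
      show "norm (\<Prod>b\<in>A - {0}. blaschke r b 0 ^ m b) > 0"
        using r fin by (auto simp: blaschke_def)
      have "norm (\<Prod>b\<in>A - {0}. blaschke r b 0 ^ m b) = (\<Prod>b\<in>A - {0}. (norm b / r) ^ m b)"
        by (simp add: norm_power b0 flip: prod_norm)
      also have "ln \<dots> = (\<Sum>b\<in>A - {0}. ln ((norm b / r) ^ m b))"
        using fin r by (intro ln_prod) auto
      also have "\<dots> = (\<Sum>a\<in>A - {0}. - (real (m a) * ln (r / norm a)))"
        using r by (intro sum.cong) (auto simp: ln_realpow ln_div right_diff_distrib)
      finally show "ln (norm (\<Prod>b\<in>A - {0}. blaschke r b 0 ^ m b)) = - (\<Sum>a\<in>A - {0}. real (m a) * ln (r / norm a))"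
        by (simp add: sum_negf)
    qed
    note ipc = integrated_pole_count_eq[OF fmero r, folded A_def]
    \<comment> \<open>a single nonvanishing coordinate suffices: \<open>P\<close> if the origin is a pole of \<open>f\<close>, and \<open>\<Lambda>\<close> otherwise\<close>
    have w0: "w 0 \<ge> 2 * (c0 - integrated_pole_count r f)"
    proof -
      have "\<exists>X>0. X ^ 2 \<le> norm (P 0) ^ 2 + norm (Q 0) ^ 2 + norm (\<Lambda> 0) ^ 2 \<and> ln X = c0 - integrated_pole_count r f"
      proof (cases "is_pole f 0")
        case True
        then have 0: "0 \<in> A" using r by (simp add: A_def)
        have pc: "pole_count 0 f = m 0"
        proof -
          have "{z. norm z \<le> 0 \<and> is_pole f z} = {0}" using True by auto
          then show ?thesis by (simp add: pole_count_def m_def)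
        qed
        have K0: "norm (K 0 0) = (1 / r) ^ m 0 * norm (\<Prod>b\<in>A - {0}. blaschke r b 0 ^ m b)"
          using r by (simp add: K_def norm_mult norm_power norm_divide power2_eq_square)
        have "ln (norm (P 0)) = ln (norm (zor_poly f 0 0)) + ln (norm (K 0 0))"
          using pole[OF 0] zor[OF True] Knz[OF 0] by (simp add: norm_mult ln_mult)
        also have "ln (norm (K 0 0)) = - (real (m 0) * ln r) - (\<Sum>a\<in>A - {0}. real (m a) * ln (r / norm a))"
          unfolding K0 using lnprod r by (simp add: ln_mult ln_realpow ln_div)
        finally have "ln (norm (P 0)) = c0 - integrated_pole_count r f"
          unfolding ipc using True pc by (simp add: c0_def m_def)
        moreover have "norm (P 0) > 0" using pole[OF 0] zor[OF True] Knz[OF 0] by simp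
        ultimately show ?thesis by (intro exI[of _ "norm (P 0)"]) auto
      next
        case False
        then have 0: "0 \<notin> A" by (simp add: A_def)
        have pc: "pole_count 0 f = 0"
        proof -
          have "{z. norm z \<le> 0 \<and> is_pole f z} = {}" using False by auto
          then show ?thesis by (simp only: pole_count_def) simp
        qed
        have "R 0 = (\<Prod>b\<in>A - {0}. blaschke r b 0 ^ m b)" using 0 by (simp add: R_def)
        then have "ln (norm (\<Lambda> 0)) = ln (norm (E 0)) - (\<Sum>a\<in>A - {0}. real (m a) * ln (r / norm a))"
          unfolding \<Lambda>_def using lnprod E(2)[of 0] by (simp add: norm_mult ln_mult)
        then have "ln (norm (\<Lambda> 0)) = c0 - integrated_pole_count r f"
          unfolding ipc using False pc by (simp add: c0_def m_def)
        moreover have "norm (\<Lambda> 0) > 0" using \<Lambda>_nz[of 0] False r by simp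
        ultimately show ?thesis by (intro exI[of _ "norm (\<Lambda> 0)"]) auto
      qed
      then obtain X where X: "X > 0" "X ^ 2 \<le> norm (P 0) ^ 2 + norm (Q 0) ^ 2 + norm (\<Lambda> 0) ^ 2"
        "ln X = c0 - integrated_pole_count r f" by blast
      have "2 * ln X = ln (X ^ 2)" using X(1) by (simp add: ln_realpow)
      also have "\<dots> \<le> ln (norm (P 0) ^ 2 + norm (Q 0) ^ 2 + norm (\<Lambda> 0) ^ 2)"
        using X by (intro ln_mono) (auto intro: order.strict_trans2[of 0 "X^2"])
      finally show ?thesis by (simp add: w_def U(2) X(3))
    qed
    have cont_circ: "continuous_on {0..2*pi} (\<lambda>\<theta>. h (of_real r * cis \<theta>))" 
      if "\<And>z. norm z = r \<Longrightarrow> isCont h z" for h :: "complex \<Rightarrow> real"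
    proof (rule continuous_on_compose2[where g=h and t="sphere 0 r"])
      show "continuous_on (sphere 0 r) h" using that by (auto intro!: continuous_at_imp_continuous_on)
    qed (use r in \<open>auto intro!: continuous_intros simp: norm_mult\<close>)
    have fcont: "isCont f z" if "norm z = r" for z
      unfolding f_def using analytic npc[OF that] pole_f Ean
      by (intro continuous_intros analytic_at_imp_isCont) auto
    \<comment> \<open>this form is continuous at 0 too, where the value \<open>ln 0 = 0\<close> gives \<open>log_plus 0 = 0\<close>\<close>
    have log_plus_eq: "log_plus x = ln (max 1 x)" if "x \<ge> 0" for x
      using that by (cases "x = 0") (auto simp: log_plus_def max_def)
    have pt: "w z \<le> ln 6 + 2 * \<kappa> * (1 + r) + 2 * log_plus (norm (f z)) - norm (U z) ^ 2 / 3" 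
      if z: "norm z = r" for z
    proof -
      have zc: "z \<in> cball 0 r" using z by simp
      have np: "\<not> is_pole f z" by (rule npc[OF z])
      have "norm (R z) = 1"
        unfolding R_def prod_norm[symmetric] using norm_blaschke_circle[OF A(1) z]
        by (simp add: norm_power)
      then have L: "norm (\<Lambda> z) = norm (E z)" by (simp add: \<Lambda>_def norm_mult)
      \<comment> \<open>\<open>M\<close> dominates \<open>|P|\<close> and \<open>|\<Lambda>|\<close>, and the cubic equation then gives \<open>|Q| \<le> 2 M\<close>\<close>
      define M where "M = max 1 (norm (f z)) * exp (\<kappa> * (1 + r))"
      have e1: "1 \<le> exp (\<kappa> * (1 + r))" using \<kappa> r by simp
      have M: "norm (\<Lambda> z) \<le> M" "norm (P z) \<le> M"
      proof -
        have "norm (\<Lambda> z) \<le> 1 * exp (\<kappa> * (1 + r))" unfolding L using E(3)[of z] z by simp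
        also have "\<dots> \<le> M" unfolding M_def by (rule mult_right_mono) auto
        finally show "norm (\<Lambda> z) \<le> M" .
        have "norm (P z) = norm (f z)" using reg[OF zc np] L by (simp add: norm_mult f_def)
        also have "\<dots> \<le> max 1 (norm (f z)) * 1" by simp
        also have "\<dots> \<le> M" unfolding M_def by (rule mult_left_mono[OF e1]) auto
        finally show "norm (P z) \<le> M" .
      qed
      have M0: "M > 0" unfolding M_def by (simp add: less_max_iff_disj)
      have "P z ^ 3 + Q z ^ 3 = \<Lambda> z ^ 3"
        using reg[OF zc np] fermat[of z] np pole_f[of z] pole_iff[of z] 
        by (simp add: power_mult_distrib flip: distrib_right)
      then have "norm (Q z) ^ 3 \<le> norm (\<Lambda> z) ^ 3 + norm (P z) ^ 3"
        by (metis add_diff_cancel_left' norm_power norm_triangle_ineq4)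
      also have "\<dots> \<le> M ^ 3 + M ^ 3" using M by (intro add_mono power_mono) auto
      also have "\<dots> \<le> (2 * M) ^ 3" using M0 by (simp add: power_mult_distrib)
      finally have "norm (Q z) \<le> 2 * M"
        using M0 by (meson power_mono_iff norm_ge_zero zero_less_numeral less_imp_le mult_nonneg_nonneg zero_le_numeral)
      then have "norm (P z) ^ 2 + norm (Q z) ^ 2 + norm (\<Lambda> z) ^ 2 \<le> M ^ 2 + (2 * M) ^ 2 + M ^ 2"
        using M by (intro add_mono power_mono) auto
      also have "\<dots> = 6 * M ^ 2" by (simp add: power_mult_distrib)
      finally have "ln (norm (P z) ^ 2 + norm (Q z) ^ 2 + norm (\<Lambda> z) ^ 2) \<le> ln (6 * M ^ 2)"
        using \<Lambda>_nz[OF zc np] by (intro ln_mono) (auto intro: add_nonneg_pos)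
      also have "\<dots> = ln 6 + 2 * ln M" using M0 by (simp add: ln_mult ln_realpow)
      also have "ln M = log_plus (norm (f z)) + \<kappa> * (1 + r)"
        unfolding M_def by (subst ln_mult) (auto simp: log_plus_eq less_max_iff_disj)
      finally show ?thesis by (simp add: w_def algebra_simps)
    qed
    have int_lp: "(\<lambda>\<theta>. log_plus (norm (f (of_real r * cis \<theta>)))) integrable_on {0..2*pi}"
    proof (rule integrable_continuous_real, rule cont_circ[of "\<lambda>z. log_plus (norm (f z))"])
      fix z :: complex assume z: "norm z = r"
      have "isCont (\<lambda>z. ln (max 1 (norm (f z)))) z"
        by (intro continuous_intros fcont z) (auto simp: max_def)
      then show "isCont (\<lambda>z. log_plus (norm (f z))) z" by (simp add: log_plus_eq)
    qed
    have Ucont: "isCont U z" for z using U(1) DERIV_isCont by blast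
    have int_U: "(\<lambda>\<theta>. norm (U (of_real r * cis \<theta>)) ^ 2) integrable_on {0..2*pi}"
      by (rule integrable_continuous_real, rule cont_circ[of "\<lambda>z. norm (U z) ^ 2"])
         (intro continuous_intros Ucont)
    have int_w: "(\<lambda>\<theta>. w (of_real r * cis \<theta>)) integrable_on {0..2*pi}"
    proof (rule integrable_continuous_real, rule cont_circ)
      fix z :: complex assume z: "norm z = r"
      then have zc: "z \<in> cball 0 r" by simp
      have "norm (P z) ^ 2 + norm (Q z) ^ 2 + norm (\<Lambda> z) ^ 2 > 0"
        using \<Lambda>_nz[OF zc npc[OF z]] by (intro add_nonneg_pos) auto
      then show "isCont w z"
        unfolding w_def using reg[OF zc npc[OF z]] \<Lambda>_an[OF zc]
        by (intro continuous_intros Ucont analytic_at_imp_isCont) auto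
    qed
    define c1 where "c1 = ln 6 + 2 * \<kappa> * (1 + r)"
    have cint: "((\<lambda>\<theta>::real. c1) has_integral (2 * pi * c1)) {0..2*pi}"
      using has_integral_const_real[of c1 0 "2*pi"] by simp
    have "((\<lambda>\<theta>. c1 + 2 * log_plus (norm (f (of_real r * cis \<theta>))) - norm (U (of_real r * cis \<theta>)) ^ 2 / 3)
       has_integral (2 * pi * c1 + 2 * integral {0..2*pi} (\<lambda>\<theta>. log_plus (norm (f (of_real r * cis \<theta>))))
        - integral {0..2*pi} (\<lambda>\<theta>. norm (U (of_real r * cis \<theta>)) ^ 2) / 3)) {0..2*pi}"
      by (intro has_integral_diff has_integral_add cint has_integral_mult_right has_integral_divide
           integrable_integral int_lp int_U)
    then have "integral {0..2*pi} (\<lambda>\<theta>. w (of_real r * cis \<theta>)) \<le> 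
       2 * pi * c1 + 2 * integral {0..2*pi} (\<lambda>\<theta>. log_plus (norm (f (of_real r * cis \<theta>))))
        - integral {0..2*pi} (\<lambda>\<theta>. norm (U (of_real r * cis \<theta>)) ^ 2) / 3"
      using r by (intro has_integral_le[OF integrable_integral[OF int_w]]) 
        (auto simp: c1_def intro!: pt simp: norm_mult)
    also have "integral {0..2*pi} (\<lambda>\<theta>. log_plus (norm (f (of_real r * cis \<theta>)))) = 2 * pi * proximity_function r f"
      by (simp add: proximity_function_def)
    finally have upper: "integral {0..2*pi} (\<lambda>\<theta>. w (of_real r * cis \<theta>)) \<le> 
       2 * pi * c1 + 2 * (2 * pi * proximity_function r f)
        - integral {0..2*pi} (\<lambda>\<theta>. norm (U (of_real r * cis \<theta>)) ^ 2) / 3" .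
    have "2 * pi * (2 * (c0 - integrated_pole_count r f)) \<le> 2 * pi * w 0"
      by (rule mult_left_mono[OF w0]) simp
    note order.trans[OF order.trans[OF this sub] upper]
    then show ?thesis
      unfolding c1_def nevanlinna_characteristic_def by (simp add: algebra_simps)
  qed
  define C where "C = 12 * pi * \<kappa> + \<bar>6 * pi * ln 6 - 12 * pi * c0\<bar>"
  have "12 * pi * \<kappa> * (1 + r) + 6 * pi * ln 6 - 12 * pi * c0 \<le> C * (1 + r)" if "r > 0" for r
  proof -
    have "6 * pi * ln 6 - 12 * pi * c0 \<le> \<bar>6 * pi * ln 6 - 12 * pi * c0\<bar> * 1" by simp
    also have "\<dots> \<le> \<bar>6 * pi * ln 6 - 12 * pi * c0\<bar> * (1 + r)"
      by (rule mult_left_mono) (use that in auto)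
    finally show ?thesis by (simp add: C_def algebra_simps)
  qed
  with main show ?thesis by (intro exI[of _ C]) force
qed

end

section \<open>Finite order makes the pulled-back differential a polynomial\<close>

text \<open>
  Cauchy's integral formula on the circle of radius \<open>r\<close>; the kernel \<open>r / |w - z|\<close> is at most 2 for
  \<open>|z| \<le> r / 2\<close>, and \<open>2 x \<le> 1 + x^2\<close>.
\<close>

lemma norm_le_circle_mean_square:
  assumes U: "U holomorphic_on UNIV" and r: "0 < r" and z: "2 * norm z \<le> r"
  shows "norm (U z) \<le> 1 + integral {0..2*pi} (\<lambda>\<theta>. norm (U (of_real r * cis \<theta>)) ^ 2) / (2 * pi)"
proof -
  have Uc: "continuous_on S U" for S
    using U holomorphic_on_imp_continuous_on continuous_on_subset by blast
  have "((\<lambda>w. U w / (w - z)) has_contour_integral (2 * of_real pi * \<i> * U z)) (circlepath 0 r)"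
    using z r by (intro Cauchy_integral_circlepath_simple holomorphic_on_subset[OF U]) auto
  then have I: "((\<lambda>t. U (0 + of_real r * cis t) / (0 + of_real r * cis t - z) * of_real r * \<i> * cis t) 
      has_integral (2 * of_real pi * \<i> * U z)) {0..2*pi}"
    unfolding circlepath_def by (subst (asm) has_contour_integral_part_circlepath_iff) auto
  have Uint: "(\<lambda>\<theta>. norm (U (of_real r * cis \<theta>)) ^ 2) integrable_on {0..2*pi}"
    by (intro integrable_continuous_real continuous_intros continuous_on_compose2[OF Uc[of UNIV]]) auto
  have "norm (integral {0..2*pi} (\<lambda>t. U (0 + of_real r * cis t) / (0 + of_real r * cis t - z) * of_real r * \<i> * cis t))
    \<le> integral {0..2*pi} (\<lambda>\<theta>. 1 + norm (U (of_real r * cis \<theta>)) ^ 2)"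
  proof (rule integral_norm_bound_integral)
    show "(\<lambda>t. U (0 + of_real r * cis t) / (0 + of_real r * cis t - z) * of_real r * \<i> * cis t) integrable_on {0..2*pi}"
      using I by blast
    show "(\<lambda>\<theta>. 1 + norm (U (of_real r * cis \<theta>)) ^ 2) integrable_on {0..2*pi}"
      by (intro integrable_add Uint) auto
    fix t
    define x where "x = norm (U (of_real r * cis t))"
    have "r - norm z \<le> norm (of_real r * cis t - z)"
      using norm_triangle_ineq2[of "of_real r * cis t" z] r by (simp add: norm_mult)
    then have d: "r / 2 \<le> norm (of_real r * cis t - z)" using z by simp
    have "r / norm (of_real r * cis t - z) \<le> r / (r / 2)"
      by (intro divide_left_mono d mult_pos_pos) (use d r in linarith)+
    then have "x * (r / norm (of_real r * cis t - z)) \<le> x * 2"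
      using r by (intro mult_left_mono) (auto simp: x_def)
    also have "\<dots> \<le> 1 + x ^ 2"
      using zero_le_power2[of "x - 1"] by (simp add: power2_eq_square algebra_simps)
    finally show "norm (U (0 + of_real r * cis t) / (0 + of_real r * cis t - z) * of_real r * \<i> * cis t)
      \<le> 1 + norm (U (of_real r * cis t)) ^ 2"
      using r by (simp add: norm_mult norm_divide x_def)
  qed
  also have "integral {0..2*pi} (\<lambda>\<theta>. 1 + norm (U (of_real r * cis \<theta>)) ^ 2) =
     2 * pi + integral {0..2*pi} (\<lambda>\<theta>. norm (U (of_real r * cis \<theta>)) ^ 2)"
    using Uint by (subst integral_add) auto
  finally have "2 * pi * norm (U z) \<le> 2 * pi + integral {0..2*pi} (\<lambda>\<theta>. norm (U (of_real r * cis \<theta>)) ^ 2)"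
    using integral_unique[OF I] by (simp add: norm_mult)
  then show ?thesis by (simp add: field_simps)
qed

text \<open>
  The mean bounds \<open>U\<close> at the points of modulus \<open>R\<close>. Asking for one radius above \<open>2 R\<close> only, instead
  of all, makes it possible to avoid the circles that pass through poles.
\<close>

lemma polynomial_if_circle_mean_bounded:
  assumes U: "U holomorphic_on UNIV"
    and mean: "\<And>R. R \<ge> R0 \<Longrightarrow> \<exists>r\<ge>2 * R. integral {0..2*pi} (\<lambda>\<theta>. norm (U (of_real r * cis \<theta>)) ^ 2) \<le> B * R ^ n"
  shows "\<exists>p. \<forall>z. U z = poly p z"
proof -
  have bound: "norm (U z) \<le> (1 + \<bar>B\<bar>) * norm z ^ n" if z: "max 1 R0 \<le> norm z" for z
  proof -
    obtain r where r: "r \<ge> 2 * norm z" 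
      "integral {0..2*pi} (\<lambda>\<theta>. norm (U (of_real r * cis \<theta>)) ^ 2) \<le> B * norm z ^ n"
      using mean[of "norm z"] z by auto
    have zn: "1 \<le> norm z ^ n" using z by (simp add: one_le_power)
    have "norm (U z) \<le> 1 + integral {0..2*pi} (\<lambda>\<theta>. norm (U (of_real r * cis \<theta>)) ^ 2) / (2 * pi)"
      using r z by (intro norm_le_circle_mean_square U) auto
    also have "\<dots> \<le> 1 + \<bar>B\<bar> * norm z ^ n / (2 * pi)"
    proof -
      have "B * norm z ^ n \<le> \<bar>B\<bar> * norm z ^ n" by (rule mult_right_mono) auto
      then show ?thesis using r(2) by (simp add: divide_right_mono)
    qed
    also have "\<bar>B\<bar> * norm z ^ n / (2 * pi) \<le> \<bar>B\<bar> * norm z ^ n / 1"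
      using pi_gt3 by (intro divide_left_mono) auto
    finally show ?thesis using zn by (simp add: algebra_simps)
  qed
  have "U z = poly (\<Sum>k\<le>n. monom ((deriv ^^ k) U 0 / fact k) k) z" for z
    using Liouville_polynomial[of U "max 1 R0" "1 + \<bar>B\<bar>" n z] U bound by (simp add: poly_sum poly_monom)
  then show ?thesis by blast
qed

text \<open>
  If the characteristic is positive, this unfolds the definition of the order; otherwise the bound
  is trivial, whatever value the logarithm takes.
\<close>

lemma finite_order_imp_polynomial_bound:
  assumes "growth_order f < \<infinity>"
  shows "\<exists>n. \<forall>\<^sub>F r in at_top. nevanlinna_characteristic r f \<le> r ^ n"
proof -
  obtain n :: nat where n: "growth_order f < ereal (real n)"
    using assms less_PInf_Ex_of_nat by auto
  then have "\<forall>\<^sub>F r in at_top. ereal (ln (nevanlinna_characteristic r f) / ln r) < ereal (real n)"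
    unfolding growth_order_def by (rule Limsup_lessD)
  moreover have "\<forall>\<^sub>F r in at_top. (1::real) < r" by (rule eventually_gt_at_top)
  ultimately have "\<forall>\<^sub>F r in at_top. nevanlinna_characteristic r f \<le> r ^ n"
  proof eventually_elim
    case (elim r)
    define T where "T = nevanlinna_characteristic r f"
    show ?case
    proof (cases "T > 0")
      case True
      have "ln T < real n * ln r" using elim by (simp add: field_simps T_def)
      also have "\<dots> = ln (r ^ n)" using elim by (simp add: ln_realpow)
      finally show ?thesis using True elim by (simp add: T_def)
    next
      case False
      moreover have "0 \<le> r ^ n" using elim by simp
      ultimately show ?thesis unfolding T_def by linarith
    qed
  qed
  then show ?thesis by blast
qed

context fermat_cubic
begin

lemma u_polynomial:
  fixes E :: "complex \<Rightarrow> complex"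
  assumes E: "E holomorphic_on UNIV" "\<And>z. E z \<noteq> 0" "\<And>z. norm (E z) \<le> exp (\<kappa> * (1 + norm z))"
    and \<kappa>: "\<kappa> \<ge> 0"
    and order: "growth_order (\<lambda>z. F z * E z) < \<infinity>"
  shows "\<exists>p. \<forall>z. u z = poly p z"
proof -
  define f where "f = (\<lambda>z. F z * E z)"
  have Ean: "E analytic_on X" for X
    using E(1) analytic_on_open[OF open_UNIV] analytic_on_subset by blast
  have fm: "f meromorphic_on UNIV"
    unfolding f_def by (intro meromorphic_on_mult mero analytic_on_imp_meromorphic_on Ean)
  have "u holomorphic_on UNIV" by (intro analytic_imp_holomorphic u_analytic)
  then obtain V where V: "\<And>z. (V has_field_derivative u z) (at z)"
    using holomorphic_convex_primitive'[of UNIV u] by auto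
  define U where "U = (\<lambda>z. V z - V 0)"
  have U: "(U has_field_derivative u z) (at z)" for z
    unfolding U_def using V[of z] by (auto intro!: derivative_eq_intros)
  have U0: "U 0 = 0" by (simp add: U_def)
  obtain C where C: "\<And>r. r > 0 \<Longrightarrow> (\<forall>z. norm z = r \<longrightarrow> \<not> is_pole f z) \<Longrightarrow>
     integral {0..2*pi} (\<lambda>\<theta>. norm (U (of_real r * cis \<theta>)) ^ 2) 
       \<le> 12 * pi * nevanlinna_characteristic r f + C * (1 + r)"
    using energy_bound[OF E \<kappa> U U0] unfolding f_def by blast
  obtain n r0 where n: "\<And>r. r \<ge> r0 \<Longrightarrow> nevanlinna_characteristic r f \<le> r ^ n"
    using finite_order_imp_polynomial_bound[OF order] unfolding f_def eventually_at_top_linorder by blast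
  have "\<exists>p. \<forall>z. U z = poly p z"
  proof (rule polynomial_if_circle_mean_bounded)
    show "U holomorphic_on UNIV" using U by (meson field_differentiable_def field_differentiable_at_within holomorphic_on_def)
    fix R assume R: "R \<ge> max 1 \<bar>r0\<bar>"
    \<comment> \<open>only finitely many radii in \<open>[2 R, 3 R]\<close> are moduli of poles\<close>
    have "finite (norm ` {z. norm z \<le> 3 * R \<and> is_pole f z})"
      by (intro finite_imageI finite_poles_in_cball fm)
    moreover have "infinite {2 * R..3 * R}" using R by (intro infinite_Icc) auto
    ultimately obtain r where r: "r \<in> {2 * R..3 * R}" "r \<notin> norm ` {z. norm z \<le> 3 * R \<and> is_pole f z}"
      by (meson finite_subset subsetI)
    have np: "\<not> is_pole f z" if "norm z = r" for z
      using r that by (auto simp: image_iff)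
    have "integral {0..2*pi} (\<lambda>\<theta>. norm (U (of_real r * cis \<theta>)) ^ 2) 
       \<le> 12 * pi * nevanlinna_characteristic r f + C * (1 + r)"
      using C np r R by auto
    also have "\<dots> \<le> 12 * pi * (3 ^ n * R ^ (n + 1)) + \<bar>C\<bar> * (4 * R ^ (n + 1))"
    proof (intro add_mono mult_left_mono)
      have "nevanlinna_characteristic r f \<le> r ^ n" by (rule n) (use r R in auto)
      also have "\<dots> \<le> (3 * R) ^ n" by (rule power_mono) (use r R in auto)
      also have "\<dots> = 3 ^ n * R ^ n" by (simp add: power_mult_distrib)
      also have "\<dots> \<le> 3 ^ n * R ^ (n + 1)" by (intro mult_left_mono power_increasing) (use R in auto)
      finally show "nevanlinna_characteristic r f \<le> 3 ^ n * R ^ (n + 1)" .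
      have "C * (1 + r) \<le> \<bar>C\<bar> * (1 + r)" by (rule mult_right_mono) (use r R in auto)
      also have "\<dots> \<le> \<bar>C\<bar> * (4 * R ^ (n + 1))"
      proof (rule mult_left_mono)
        have "R ^ 1 \<le> R ^ (n + 1)" by (rule power_increasing) (use R in auto)
        then have "R \<le> R ^ (n + 1)" by (simp only: power_one_right)
        moreover have "r \<le> 3 * R" "1 \<le> R" using r R by auto
        ultimately show "1 + r \<le> 4 * R ^ (n + 1)" by linarith
      qed auto
      finally show "C * (1 + r) \<le> \<bar>C\<bar> * (4 * R ^ (n + 1))" .
    qed auto
    also have "\<dots> = (12 * pi * 3 ^ n + 4 * \<bar>C\<bar>) * R ^ (n + 1)" by (simp add: algebra_simps)
    finally show "\<exists>r\<ge>2 * R. integral {0..2*pi} (\<lambda>\<theta>. norm (U (of_real r * cis \<theta>)) ^ 2)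
       \<le> (12 * pi * 3 ^ n + 4 * \<bar>C\<bar>) * R ^ (n + 1)"
      using r by auto
  qed
  then obtain p where p: "\<And>z. U z = poly p z" by blast
  have "u z = poly (pderiv p) z" for z
  proof -
    have "U = poly p" using p by auto
    with U[of z] have "(poly p has_field_derivative u z) (at z)" by simp
    then show ?thesis using poly_DERIV by (rule DERIV_unique)
  qed
  then show ?thesis by blast
qed

end

section \<open>The shift forces the differential to vanish\<close>

lemma poly_shift_ratio_tendsto_1:
  fixes p :: "complex poly"
  assumes "p \<noteq> 0"
  shows "((\<lambda>z. poly p (z + c) / poly p z) \<longlongrightarrow> 1) at_infinity"
proof -
  define n where "n = degree p"
  have shift: "filterlim (\<lambda>z. z + c) at_infinity at_infinity"
    by (rule tendsto_add_filterlim_at_infinity'[OF filterlim_ident tendsto_const])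
  have 1: "((\<lambda>z. poly p z / z ^ n) \<longlongrightarrow> lead_coeff p) at_infinity"
    unfolding n_def by (rule poly_divide_tendsto_aux)
  then have 2: "((\<lambda>z. poly p (z + c) / (z + c) ^ n) \<longlongrightarrow> lead_coeff p) at_infinity"
    by (rule filterlim_compose[OF _ shift])
  have "((\<lambda>z. 1 + c * inverse z) \<longlongrightarrow> 1 + c * 0) at_infinity"
    by (intro tendsto_intros tendsto_inverse_0)
  then have "((\<lambda>z. (1 + c * inverse z) ^ n) \<longlongrightarrow> 1) at_infinity"
    using tendsto_power[of _ 1 _ n] by fastforce
  from tendsto_divide[OF tendsto_mult[OF 2 this] 1] assms
  have lim: "((\<lambda>z. poly p (z + c) / (z + c) ^ n * (1 + c * inverse z) ^ n / (poly p z / z ^ n)) \<longlongrightarrow> 1) at_infinity"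
    by simp
  have "\<forall>\<^sub>F z in at_infinity. z \<noteq> 0" "\<forall>\<^sub>F z in at_infinity. z + c \<noteq> 0"
    by (simp_all add: filterlim_at_infinity_imp_eventually_ne filterlim_ident)
      (rule filterlim_at_infinity_imp_eventually_ne[OF shift])
  then have "\<forall>\<^sub>F z in at_infinity. poly p (z + c) / (z + c) ^ n * (1 + c * inverse z) ^ n / (poly p z / z ^ n)
      = poly p (z + c) / poly p z"
  proof eventually_elim
    case (elim z)
    have "1 + c * inverse z = (z + c) / z" using elim by (simp add: field_simps)
    then show ?case using elim by (simp add: power_divide)
  qed
  with lim show ?thesis by (rule Lim_transform_eventually)
qed

text \<open>
  Cauchy's inequality on the disc of radius \<open>|z| / 2\<close> around \<open>z\<close>, on which all singularities are
  removable.
\<close>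

lemma deriv_bound_of_bounded_meromorphic:
  assumes D: "D meromorphic_on UNIV"
    and bd: "\<And>w. R \<le> norm w \<Longrightarrow> \<forall>\<^sub>F v in at w. norm (D v) \<le> B"
    and z: "D analytic_on {z}" "2 * R \<le> norm z" "0 < norm z"
  shows "norm (deriv D z) \<le> 2 * B / norm z"
proof -
  define D0 where "D0 = remove_sings D"
  have far: "R \<le> norm w" if "w \<in> cball z (norm z / 2)" for w
  proof -
    have "norm z - norm w \<le> norm z / 2"
      using that norm_triangle_ineq2[of z w] by (simp add: dist_norm)
    then show ?thesis using z(2) by simp
  qed
  have an: "D0 analytic_on {w}" if "R \<le> norm w" for w
    unfolding D0_def by (rule bounded_imp_analytic_remove_sings[OF meromorphic_on_subset[OF D] bd[OF that]]) simp
  have le: "norm (D0 w) \<le> B" if w: "R \<le> norm w" for w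
  proof -
    have "D0 \<midarrow>w\<rightarrow> D0 w" by (rule isContD[OF analytic_at_imp_isCont[OF an[OF w]]])
    moreover have "\<forall>\<^sub>F v in at w. norm (D0 v) \<le> B"
      using bd[OF w] eventually_remove_sings_eq_at[OF meromorphic_on_isolated_singularity[OF meromorphic_on_subset[OF D]], of w]
      unfolding D0_def by (auto elim: eventually_elim2)
    ultimately show ?thesis by (rule Lim_norm_ubound[OF at_neq_bot])
  qed
  have "D0 analytic_on cball z (norm z / 2)"
    using an far analytic_on_analytic_at by blast
  then have hol: "D0 holomorphic_on cball z (norm z / 2)" by (rule analytic_imp_holomorphic)
  have "norm ((deriv ^^ 1) D0 z) \<le> fact 1 * B / (norm z / 2) ^ 1"
  proof (rule Cauchy_inequality)
    show "D0 holomorphic_on ball z (norm z / 2)"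
      using holomorphic_on_subset[OF hol ball_subset_cball] .
    show "continuous_on (cball z (norm z / 2)) D0" by (rule holomorphic_on_imp_continuous_on[OF hol])
    show "norm (D0 x) \<le> B" if "norm (z - x) = norm z / 2" for x
      by (rule le, rule far) (simp add: dist_norm that)
  qed (use z in auto)
  then show ?thesis using z(1) by (simp add: D0_def mult.commute)
qed

text \<open>
  After division by \<open>exp ((\<alpha> z + \<beta>) / 3)\<close> the shifted function becomes a constant multiple of
  \<open>F (z + c)\<close>, with \<open>K = exp (\<alpha> c / 3)\<close>.
\<close>

locale fermat_difference = fermat_cubic +
  fixes c K :: complex
  assumes K: "K \<noteq> 0" and G_eq: "\<And>z. G z = K * F (z + c)"
begin

lemma regular_shift:
  assumes "\<not> is_pole F z"
  shows "\<not> is_pole F (z + c)"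
proof
  assume "is_pole F (z + c)"
  then have "is_pole (F \<circ> (+) c) z" by (simp add: is_pole_shift_iff)
  then have "is_pole (\<lambda>w. K * F (w + c)) z" using K by (simp add: o_def add.commute)
  moreover have "(\<lambda>w. K * F (w + c)) = G" using G_eq by auto
  ultimately show False using pole_iff assms by simp
qed

text \<open>
  Differentiating \<open>G(z) = K F(z + c)\<close> gives \<open>K u(z + c) G(z + c)^2 = - u(z) F(z)^2\<close>. Cubing
  leaves only \<open>G(z + c)^3\<close>, which the equation at \<open>z\<close> and at \<open>z + c\<close> expresses by \<open>F(z)^3\<close>.
\<close>

lemma u_shift:
  assumes z: "\<not> is_pole F z"
  shows "u (z + c) ^ 3 * (K ^ 3 - 1 + F z ^ 3) ^ 2 = - (K ^ 3) * (u z ^ 3 * (F z ^ 3) ^ 2)"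
proof -
  note zc = regular_shift[OF z]
  have "(G has_field_derivative K * deriv F (z + c)) (at z)"
  proof -
    have "((\<lambda>w. F (w + c)) has_field_derivative deriv F (z + c)) (at z)"
      using derivs(1)[OF zc] by (simp add: DERIV_shift)
    then have "((\<lambda>w. K * F (w + c)) has_field_derivative K * deriv F (z + c)) (at z)"
      by (rule DERIV_cmult)
    moreover have "(\<lambda>w. K * F (w + c)) = G" using G_eq by auto
    ultimately show ?thesis by simp
  qed
  then have "K * deriv F (z + c) = deriv G z" using derivs(2)[OF z] by (blast intro: DERIV_unique)
  then have 1: "K * (u (z + c) * G (z + c) ^ 2) = - u z * F z ^ 2"
    by (simp add: u_eqs[OF z] u_eqs[OF zc])
  have 2: "F z ^ 3 + G z ^ 3 = 1" "F (z + c) ^ 3 + G (z + c) ^ 3 = 1"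
    using fermat z zc pole_iff by auto
  have "K ^ 3 * G (z + c) ^ 3 = K ^ 3 - 1 + F z ^ 3"
    using 2 by (simp add: G_eq[of z] power_mult_distrib algebra_simps) (algebra)
  then have "u (z + c) ^ 3 * (K ^ 3 - 1 + F z ^ 3) ^ 2 = K ^ 3 * (K * (u (z + c) * G (z + c) ^ 2)) ^ 3"
    by (simp only: flip: \<open>K ^ 3 * G (z + c) ^ 3 = K ^ 3 - 1 + F z ^ 3\<close>) (simp add: power_mult_distrib mult_ac flip: power_mult power_add)
  also have "\<dots> = - (K ^ 3) * (u z ^ 3 * (F z ^ 3) ^ 2)"
    unfolding 1 by (simp add: power_mult_distrib flip: power_mult)
  finally show ?thesis .
qed

text \<open>
  Write \<open>k = K^3\<close>. The cubed quotient \<open>(u(z + c) / u(z))^3\<close> is close to 1 near infinity, and by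
  \<open>u_shift\<close> its product with \<open>(k - 1 + F^3)^2\<close> is \<open>- k (F^3)^2\<close>. If \<open>k \<noteq> 1\<close>, this is
  impossible for small \<open>F\<close>. If \<open>k = 1\<close>, the relation forces \<open>F(z) = 0\<close> at every large regular
  \<open>z\<close>, hence also \<open>F(z + c) = 0\<close>, against \<open>F(z)^3 + F(z + c)^3 = 1\<close>; so there are no such
  points at all.
\<close>

lemma F_bounded_below_near_infinity:
  assumes p: "\<And>z. u z = poly p z" "p \<noteq> 0"
  shows "\<exists>\<delta>>0. \<exists>R. \<forall>z. R \<le> norm z \<longrightarrow> \<not> is_pole F z \<longrightarrow> \<delta> \<le> norm (F z)"
proof -
  define k where "k = K ^ 3"
  have k: "k \<noteq> 0" using K by (simp add: k_def)
  have "((\<lambda>z. (poly p (z + c) / poly p z) ^ 3) \<longlongrightarrow> 1 ^ 3) at_infinity"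
    by (intro tendsto_power poly_shift_ratio_tendsto_1 p)
  then have "\<forall>\<^sub>F z in at_infinity. dist ((poly p (z + c) / poly p z) ^ 3) 1 < 1 / 2"
    by (intro tendstoD) auto
  moreover have "\<forall>\<^sub>F z in at_infinity. poly p z \<noteq> 0"
    using poly_roots_finite[OF p(2)]
    by (metis (mono_tags, lifting) eventually_at_infinity finite_imp_bounded bounded_pos mem_Collect_eq not_le order.strict_trans2 gt_ex)
  ultimately have "\<forall>\<^sub>F z in at_infinity. dist ((poly p (z + c) / poly p z) ^ 3) 1 < 1 / 2 \<and> poly p z \<noteq> 0"
    by eventually_elim simp
  then obtain R where R: "\<And>z. R \<le> norm z \<Longrightarrow> dist ((u (z + c) / u z) ^ 3) 1 < 1 / 2 \<and> u z \<noteq> 0"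
    unfolding eventually_at_infinity p(1) by blast
  have key: "(u (z + c) / u z) ^ 3 * (k - 1 + F z ^ 3) ^ 2 = - k * (F z ^ 3) ^ 2"
    if "R \<le> norm z" "\<not> is_pole F z" for z
    using u_shift[OF that(2)] R[OF that(1)] by (simp add: k_def field_simps power_divide)
  show ?thesis
  proof (cases "k = 1")
    case True
    have F0: "F z = 0" if z: "R \<le> norm z" "\<not> is_pole F z" for z
    proof (rule ccontr)
      assume F: "F z \<noteq> 0"
      have "(u (z + c) / u z) ^ 3 * (F z ^ 3) ^ 2 = (- 1) * (F z ^ 3) ^ 2"
        using key[OF z] True by simp
      then have "(u (z + c) / u z) ^ 3 = - 1"
        using F by (subst (asm) mult_cancel_right) simp
      then show False using R[OF z(1)] by (simp add: dist_norm)
    qed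
    have "1 \<le> norm (F z)" if z: "R + norm c \<le> norm z" "\<not> is_pole F z" for z
    proof -
      have "R \<le> norm (z + c)" using z norm_triangle_ineq4[of "z + c" c] by simp
      then have "F (z + c) = 0" using F0 regular_shift[OF z(2)] by blast
      moreover have "F z = 0" using F0[OF _ z(2)] z(1) norm_ge_zero[of c] by linarith
      ultimately show ?thesis using fermat[of z] z pole_iff G_eq[of z] by simp
    qed
    then show ?thesis by (intro exI[of _ 1]) auto
  next
    case False
    define t where "t = norm (k - 1)"
    have t: "t > 0" using False by (simp add: t_def)
    \<comment> \<open>small enough for \<open>|k| \<delta>^2 \<le> t^2 / 16\<close>, which is less than \<open>(3 t / 4)^2 / 2\<close>\<close>
    define \<delta> where "\<delta> = t / (4 * (1 + norm k))"
    have \<delta>: "\<delta> > 0" unfolding \<delta>_def using t by (simp add: add_pos_nonneg)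
    have \<delta>t: "\<delta> \<le> t / 4" unfolding \<delta>_def using t by (intro divide_left_mono) (auto intro: mult_pos_pos add_pos_nonneg)
    have k\<delta>: "norm k * \<delta> ^ 2 \<le> t ^ 2 / 16"
    proof -
      have "(1 + norm k) * \<delta> = t / 4" unfolding \<delta>_def using add_pos_nonneg[of 1 "norm k"] by (simp add: field_simps)
      then have "((1 + norm k) * \<delta>) ^ 2 = t ^ 2 / 16" by (simp only: power_divide) simp
      moreover have "norm k * \<delta> ^ 2 \<le> (1 + norm k) ^ 2 * \<delta> ^ 2"
        by (intro mult_right_mono) (auto simp: power2_eq_square algebra_simps)
      ultimately show ?thesis by (simp add: power_mult_distrib)
    qed
    have "\<delta> \<le> norm (F z) ^ 3" if z: "R \<le> norm z" "\<not> is_pole F z" for z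
    proof (rule ccontr)
      assume "\<not> \<delta> \<le> norm (F z) ^ 3"
      then have x: "norm (F z ^ 3) < \<delta>" by (simp add: norm_power)
      have q: "1 / 2 \<le> norm ((u (z + c) / u z) ^ 3)"
      proof -
        have "norm (1 :: complex) - norm ((u (z + c) / u z) ^ 3) \<le> norm (1 - (u (z + c) / u z) ^ 3)"
          by (rule norm_triangle_ineq2)
        then show ?thesis using R[OF z(1)] by (simp add: dist_norm norm_minus_commute)
      qed
      have "t - norm (F z ^ 3) \<le> norm (k - 1 + F z ^ 3)"
        unfolding t_def using norm_triangle_ineq2[of "k - 1" "- (F z ^ 3)"] by simp
      then have "3 * t / 4 \<le> norm (k - 1 + F z ^ 3)" using x \<delta>t by simp
      then have "(3 * t / 4) ^ 2 \<le> norm (k - 1 + F z ^ 3) ^ 2" by (rule power_mono) (use t in auto)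
      then have "1 / 2 * (3 * t / 4) ^ 2 \<le> norm ((u (z + c) / u z) ^ 3) * norm (k - 1 + F z ^ 3) ^ 2"
        using q by (intro mult_mono) auto
      also have "\<dots> = norm k * norm (F z ^ 3) ^ 2"
        using arg_cong[OF key[OF z], of norm] by (simp only: norm_mult norm_power norm_minus_cancel)
      also have "\<dots> \<le> norm k * \<delta> ^ 2"
        using x by (intro mult_left_mono power_mono) auto
      also have "\<dots> \<le> t ^ 2 / 16" by (rule k\<delta>)
      finally have "t ^ 2 \<le> 0" by (simp add: power2_eq_square)
      then show False using t by simp
    qed
    moreover have "min 1 \<delta> \<le> norm (F z)" if "\<delta> \<le> norm (F z) ^ 3" for z
    proof (cases "norm (F z) \<le> 1")
      case True
      then have "norm (F z) ^ 3 \<le> norm (F z) ^ 1" by (intro power_decreasing) auto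
      then show ?thesis using that by simp
    qed auto
    ultimately show ?thesis using \<delta> by (intro exI[of _ "min 1 \<delta>"]) auto
  qed
qed

text \<open>
  With \<open>H = 1 / F\<close> and \<open>J = G / F\<close> the curve becomes \<open>1 + J^3 = H^3\<close>, and \<open>H' = - u J^2\<close>,
  \<open>J' = - u H^2\<close>. Both functions are bounded near infinity, so their derivatives are \<open>O(1 / |z|)\<close>.
  As \<open>H\<close> and \<open>J\<close> are never both small, \<open>u\<close> itself is \<open>O(1 / |z|)\<close>, and Liouville's theorem applies.
\<close>

lemma u_eq_0:
  assumes p: "\<And>z. u z = poly p z"
  shows "u z = 0"
proof (rule ccontr)
  assume "u z \<noteq> 0"
  then have "p \<noteq> 0" using p by auto
  with p obtain \<delta> R0 where \<delta>: "\<delta> > 0" and below: "\<And>z. R0 \<le> norm z \<Longrightarrow> \<not> is_pole F z \<Longrightarrow> \<delta> \<le> norm (F z)"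
    using F_bounded_below_near_infinity by blast
  define B where "B = 1 / \<delta> + 1"
  have B: "B > 0" using \<delta> by (simp add: B_def add_pos_pos)
  define H where "H = (\<lambda>z. inverse (F z))"
  define J where "J = (\<lambda>z. G z * inverse (F z))"
  have mHJ: "H meromorphic_on UNIV" "J meromorphic_on UNIV"
    unfolding H_def J_def by (intro meromorphic_intros mero)+
  have bounds: "norm (H z) \<le> B \<and> norm (J z) \<le> B \<and> 1 + J z ^ 3 = H z ^ 3"
    if z: "R0 \<le> norm z" "\<not> is_pole F z" for z
  proof -
    have Fz: "F z \<noteq> 0" using below[OF z] \<delta> by auto
    have "norm (H z) \<le> 1 / \<delta>"
      using below[OF z] \<delta> by (simp add: H_def inverse_eq_divide norm_divide frac_le)
    then have H: "norm (H z) \<le> 1 / \<delta>" "norm (H z) \<le> B" by (auto simp: B_def)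
    have "F z ^ 3 + G z ^ 3 = 1" using fermat z pole_iff by auto
    then have eq: "1 + J z ^ 3 = H z ^ 3"
      using Fz by (simp add: J_def H_def power_mult_distrib field_simps)
    then have "norm (J z) ^ 3 = norm (H z ^ 3 - 1)"
      by (metis add_diff_cancel_left' norm_power)
    also have "\<dots> \<le> norm (H z) ^ 3 + 1"
      by (metis norm_one norm_power norm_triangle_ineq4)
    also have "\<dots> \<le> (norm (H z) + 1) ^ 3" by (simp add: power3_eq_cube algebra_simps)
    also have "\<dots> \<le> B ^ 3" using H by (intro power_mono) (auto simp: B_def)
    finally have "norm (J z) \<le> B" using B by (meson power_mono_iff norm_ge_zero zero_less_numeral less_imp_le)
    with H eq show ?thesis by simp
  qed
  define R where "R = max 1 (R0 + 1)"
  have ev: "\<forall>\<^sub>F v in at w. norm (H v) \<le> B" "\<forall>\<^sub>F v in at w. norm (J v) \<le> B" if "R \<le> norm w" for w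
  proof -
    have "R0 < norm w" using that by (simp add: R_def)
    then have "\<forall>\<^sub>F v in at w. R0 < norm v"
      by (intro order_tendstoD(1)[OF tendsto_norm[OF tendsto_ident_at]])
    with eventually_regular[of w] 
    show "\<forall>\<^sub>F v in at w. norm (H v) \<le> B" "\<forall>\<^sub>F v in at w. norm (J v) \<le> B"
      by (eventually_elim; use bounds in force)+
  qed
  have u_reg: "norm (u z) \<le> 16 * B / norm z" if z: "2 * R \<le> norm z" "\<not> is_pole F z" for z
  proof -
    have "1 \<le> R" "R0 + 1 \<le> R" by (auto simp: R_def)
    then have z0: "R0 \<le> norm z" "0 < norm z" using z(1) by linarith+
    have Fz: "F z \<noteq> 0" using below[OF z0(1) z(2)] \<delta> by auto
    have anHJ: "H analytic_on {z}" "J analytic_on {z}"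
      unfolding H_def J_def using Fz by (auto intro!: analytic_intros analytic z)
    note d = derivs[OF z(2)]
    have "deriv H z = - (u z * J z ^ 2)"
    proof (rule DERIV_imp_deriv)
      show "(H has_field_derivative - (u z * J z ^ 2)) (at z)"
        unfolding H_def J_def
        by (rule derivative_eq_intros d Fz refl)+
           (use Fz in \<open>simp add: u_eqs[OF z(2)] power2_eq_square field_simps\<close>)
    qed
    then have 1: "norm (u z) * norm (J z) ^ 2 \<le> 2 * B / norm z"
      using deriv_bound_of_bounded_meromorphic[OF mHJ(1) ev(1) anHJ(1) z(1) z0(2)]
      by (simp add: norm_mult norm_power)
    have "deriv J z = - (u z * H z ^ 2)"
    proof (rule DERIV_imp_deriv)
      have "- (F z ^ 3 + G z ^ 3) * u z = - u z" using fermat z pole_iff by auto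
      then have "deriv G z * F z - G z * deriv F z = - u z"
        by (simp add: u_eqs[OF z(2)] power2_eq_square power3_eq_cube algebra_simps)
      then have quot: "(deriv G z * F z - G z * deriv F z) / (F z) ^ 2 = - (u z * H z ^ 2)"
        by (simp add: H_def power_inverse divide_inverse)
      have "(J has_field_derivative (deriv G z * F z - G z * deriv F z) / (F z) ^ 2) (at z)"
        unfolding J_def
        by (rule derivative_eq_intros d Fz refl)+
           (use Fz in \<open>simp add: power2_eq_square field_simps\<close>)
      then show "(J has_field_derivative - (u z * H z ^ 2)) (at z)"
        using quot by (rule DERIV_cong)
    qed
    then have 2: "norm (u z) * norm (H z) ^ 2 \<le> 2 * B / norm z"
      using deriv_bound_of_bounded_meromorphic[OF mHJ(2) ev(2) anHJ(2) z(1) z0(2)]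
      by (simp add: norm_mult norm_power)
    have big: "1 / 4 \<le> norm (J z) ^ 2 + norm (H z) ^ 2"
    proof (rule ccontr)
      assume *: "\<not> 1 / 4 \<le> norm (J z) ^ 2 + norm (H z) ^ 2"
      have "norm (J z) ^ 2 < 1 / 4" "norm (H z) ^ 2 < 1 / 4"
        using * zero_le_power2[of "norm (J z)"] zero_le_power2[of "norm (H z)"] by linarith+
      then have "norm (J z) ^ 2 < (1 / 2) ^ 2" "norm (H z) ^ 2 < (1 / 2) ^ 2"
        by (simp_all add: power_divide)
      then have small: "norm (J z) < 1 / 2" "norm (H z) < 1 / 2"
        using power_less_imp_less_base[of "norm (J z)" 2 "1 / 2"]
          power_less_imp_less_base[of "norm (H z)" 2 "1 / 2"] by simp_all
      have "1 = norm (H z ^ 3 - J z ^ 3)"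
        using bounds[OF z0(1) z(2)] by (metis add_diff_cancel_right' norm_one)
      also have "\<dots> \<le> norm (H z) ^ 3 + norm (J z) ^ 3"
        by (metis norm_power norm_triangle_ineq4)
      also have "\<dots> \<le> (1 / 2) ^ 3 + (1 / 2) ^ 3"
        using small by (intro add_mono power_mono) auto
      finally show False by (simp add: power_divide)
    qed
    have "norm (u z) * (1 / 4) \<le> norm (u z) * (norm (J z) ^ 2 + norm (H z) ^ 2)"
      by (rule mult_left_mono[OF big]) simp
    also have "\<dots> \<le> 2 * B / norm z + 2 * B / norm z"
      unfolding distrib_left using 1 2 by (rule add_mono)
    finally show ?thesis by simp
  qed
  have u_all: "norm (u z) \<le> 16 * B / norm z" if z: "2 * R < norm z" for z
  proof -
    have "1 \<le> R" by (simp add: R_def)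
    then have z0: "norm z > 0" using z by linarith
    have "u \<midarrow>z\<rightarrow> u z" by (rule isContD[OF analytic_at_imp_isCont[OF u_analytic]])
    then have 1: "((\<lambda>w. norm (u w)) \<longlongrightarrow> norm (u z)) (at z)" by (rule tendsto_norm)
    have 2: "((\<lambda>w. 16 * B / norm w) \<longlongrightarrow> 16 * B / norm z) (at z)"
      using z0 by (intro tendsto_intros) auto
    have "\<forall>\<^sub>F w in at z. 2 * R < norm w"
      using z by (intro order_tendstoD(1)[OF tendsto_norm[OF tendsto_ident_at]])
    with eventually_regular[of z] have "\<forall>\<^sub>F w in at z. norm (u w) \<le> 16 * B / norm w"
      by eventually_elim (use u_reg in auto)
    then show ?thesis by (rule tendsto_le[OF at_neq_bot 2 1])
  qed
  have "(u \<longlongrightarrow> 0) at_infinity"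
  proof (rule Lim_null_comparison)
    show "\<forall>\<^sub>F w in at_infinity. norm (u w) \<le> 16 * B * norm (inverse w)"
      using u_all by (intro eventually_at_infinityI[of "2 * R + 1"]) (auto simp: norm_inverse divide_inverse)
    show "((\<lambda>w. 16 * B * norm (inverse w :: complex)) \<longlongrightarrow> 0) at_infinity"
      using tendsto_mult_right_zero[OF tendsto_norm_zero[OF tendsto_inverse_0]] by auto
  qed
  then have "u z = 0"
    using Liouville_weak_0[of u] analytic_imp_holomorphic[OF u_analytic] by blast
  with \<open>u z \<noteq> 0\<close> show False by simp
qed

text \<open>
  If \<open>u = 0\<close>, then \<open>F' = u G^2 = 0\<close> off the poles, whose complement is connected. A function that
  is constant near a point has no pole there.
\<close>

lemma constant_if_u_eq_0:
  assumes u0: "\<And>z. u z = 0"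
  shows "\<exists>d. (\<forall>z. F z = d) \<and> d ^ 3 * (1 + K ^ 3) = 1"
proof -
  have sparse: "{z. is_pole F z} sparse_in UNIV"
    using meromorphic_on_imp_not_pole_cosparse[OF mero(1)] by (simp add: eventually_cosparse)
  have "connected (UNIV - {z. is_pole F z})"
    by (rule sparse_imp_connected[OF _ _ _ sparse]) auto
  moreover have "UNIV - {z. is_pole F z} = {z. \<not> is_pole F z}" by auto
  ultimately have conn: "connected {z. \<not> is_pole F z}" by simp
  have deriv0: "(F has_field_derivative 0) (at z)" if "\<not> is_pole F z" for z
    using derivs(1)[OF that] u_eqs(1)[OF that] u0 by simp
  then obtain d where d: "\<And>z. \<not> is_pole F z \<Longrightarrow> F z = d"
  proof -
    assume goal: "\<And>d. (\<And>z. \<not> is_pole F z \<Longrightarrow> F z = d) \<Longrightarrow> thesis"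
    have "continuous_on {z. \<not> is_pole F z} F"
      using derivs(1) DERIV_isCont by (blast intro: continuous_at_imp_continuous_on)
    then obtain d where "\<And>z. z \<in> {z. \<not> is_pole F z} \<Longrightarrow> F z = d"
      using DERIV_zero_connected_constant[OF conn open_regular finite.emptyI, of F] deriv0 by auto
    then show thesis by (intro goal) auto
  qed
  have no_pole: "\<not> is_pole F z" for z
  proof (rule frequently_const_imp_not_is_pole)
    have "\<forall>\<^sub>F w in at z. F w = d"
      using eventually_regular[of z] by eventually_elim (use d in auto)
    then show "\<exists>\<^sub>F w in at z. F w = d" by (rule eventually_frequently[OF at_neq_bot])
  qed
  then have F: "F z = d" for z using d by blast
  have "d ^ 3 + (K * d) ^ 3 = 1"
    using fermat[of 0] no_pole pole_iff by (simp add: F G_eq)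
  then have "d ^ 3 * (1 + K ^ 3) = 1" by (simp add: power_mult_distrib algebra_simps)
  with F show ?thesis by blast
qed

end

section \<open>The difference equation\<close>

lemma nicely_meromorphic_mult_nonvanishing:
  assumes h: "h nicely_meromorphic_on UNIV" and e: "\<And>z. e analytic_on {z}" "\<And>z. e z \<noteq> 0"
  shows "(\<lambda>z. h z * e z) nicely_meromorphic_on UNIV"
  unfolding nicely_meromorphic_on_def
proof (intro conjI ballI)
  have "e analytic_on UNIV" using e(1) analytic_on_analytic_at by blast
  then show "(\<lambda>z. h z * e z) meromorphic_on UNIV"
    using h unfolding nicely_meromorphic_on_def
    by (intro meromorphic_on_mult) (blast intro: analytic_on_imp_meromorphic_on)+
  fix z :: complex
  have "e \<midarrow>z\<rightarrow> e z" by (rule isContD[OF analytic_at_imp_isCont[OF e(1)]])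
  moreover have "is_pole h z \<and> h z = 0 \<or> h \<midarrow>z\<rightarrow> h z"
    using h by (auto simp: nicely_meromorphic_on_def)
  moreover have "is_pole (\<lambda>z. h z * e z) z \<longleftrightarrow> is_pole h z"
    by (rule is_pole_mult_analytic_nonzero2_iff[OF e])
  ultimately show "is_pole (\<lambda>z. h z * e z) z \<and> h z * e z = 0 \<or> (\<lambda>z. h z * e z) \<midarrow>z\<rightarrow> h z * e z"
    by (auto intro: tendsto_mult)
qed

lemma nicely_meromorphic_shift:
  fixes c :: complex
  assumes h: "h nicely_meromorphic_on UNIV"
  shows "(\<lambda>z. h (z + c)) nicely_meromorphic_on UNIV"
  unfolding nicely_meromorphic_on_def
proof (intro conjI ballI)
  have "h meromorphic_on UNIV" using h by (simp add: nicely_meromorphic_on_def)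
  then show "(\<lambda>z. h (z + c)) meromorphic_on UNIV"
    by (rule meromorphic_on_compose) (auto intro!: analytic_intros)
  fix z :: complex
  have "is_pole h (z + c) \<and> h (z + c) = 0 \<or> h \<midarrow>z + c\<rightarrow> h (z + c)"
    using h by (simp add: nicely_meromorphic_on_def)
  moreover have "is_pole (\<lambda>w. h (w + c)) z \<longleftrightarrow> is_pole h (z + c)"
    using is_pole_shift_iff[of h c z] by (simp add: o_def add.commute)
  moreover have "(\<lambda>w. h (w + c)) \<midarrow>z\<rightarrow> h (z + c)" if "h \<midarrow>z + c\<rightarrow> h (z + c)"
    using LIM_offset[OF that, of c] by simp
  ultimately show "is_pole (\<lambda>w. h (w + c)) z \<and> h (z + c) = 0 \<or> (\<lambda>w. h (w + c)) \<midarrow>z\<rightarrow> h (z + c)"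
    by blast
qed

theorem theorem3:
  fixes \<alpha> \<beta> c :: complex and f :: "complex \<Rightarrow> complex"
  assumes "c \<noteq> 0"
    and "f nicely_meromorphic_on UNIV"
    and "solves_fermat_difference_eq \<alpha> \<beta> c f"
    and "growth_order f < \<infinity>"
  shows "trivial_solution \<alpha> \<beta> c f"
proof -
  define E where "E = (\<lambda>z. exp ((\<alpha> * z + \<beta>) / 3))"
  define K where "K = exp (\<alpha> * c / 3)"
  define F where "F = (\<lambda>z. f z * inverse (E z))"
  define G where "G = (\<lambda>z. K * F (z + c))"
  have E_hol: "E holomorphic_on UNIV" unfolding E_def by (intro holomorphic_intros) auto
  have E_nz: "E z \<noteq> 0" for z by (simp add: E_def)
  have E_an: "E analytic_on {z}" for z
    using holomorphic_on_imp_analytic_at[OF E_hol open_UNIV] by simp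
  have E_shift: "E (z + c) = K * E z" for z
    by (simp add: E_def K_def flip: exp_add) (simp add: algebra_simps add_divide_distrib)
  have exp_third: "exp (x / 3) ^ 3 = exp x" for x :: complex
    using exp_of_nat_mult[of 3 "x / 3"] by simp
  have cube: "E z ^ 3 = exp (\<alpha> * z + \<beta>)" "K ^ 3 = exp (\<alpha> * c)" for z
    unfolding E_def K_def by (rule exp_third)+
  have inv_an: "(\<lambda>z. inverse (E z)) analytic_on {z}" for z
    using E_nz by (intro analytic_intros E_an) auto
  have F: "F nicely_meromorphic_on UNIV"
    unfolding F_def by (intro nicely_meromorphic_mult_nonvanishing assms(2) inv_an) (simp add: E_nz)
  have pole_F: "is_pole F z \<longleftrightarrow> is_pole f z" for z
    unfolding F_def by (rule is_pole_mult_analytic_nonzero2_iff[OF inv_an]) (simp add: E_nz)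
  have f_eq: "F z * E z = f z" for z by (simp add: F_def E_nz)
  interpret fermat_difference F G c K
  proof
    show "F nicely_meromorphic_on UNIV" by (rule F)
    show "G nicely_meromorphic_on UNIV"
      unfolding G_def by (intro nicely_meromorphic_on_cmult_left nicely_meromorphic_shift F)
    show "K \<noteq> 0" by (simp add: K_def)
    show "G z = K * F (z + c)" for z by (simp add: G_def)
    fix z assume z: "\<not> is_pole F z" "\<not> is_pole G z"
    have "is_pole G z \<longleftrightarrow> is_pole (F \<circ> (+) c) z"
      using \<open>K \<noteq> 0\<close> by (simp add: G_def o_def add.commute)
    then have zc: "\<not> is_pole F (z + c)" using z by (simp add: is_pole_shift_iff)
    \<comment> \<open>the factor \<open>K\<close> in \<open>G\<close> cancels the one in \<open>E (z + c) = K E(z)\<close>\<close>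
    have "G z = f (z + c) * inverse (E z)"
      using \<open>K \<noteq> 0\<close> by (simp add: G_def F_def E_shift)
    then have "F z ^ 3 + G z ^ 3 = (f z ^ 3 + f (z + c) ^ 3) * inverse (E z ^ 3)"
      by (simp add: F_def power_mult_distrib power_inverse algebra_simps)
    also have "f z ^ 3 + f (z + c) ^ 3 = E z ^ 3"
      using assms(3) z zc pole_F unfolding cube solves_fermat_difference_eq_def by auto
    finally show "F z ^ 3 + G z ^ 3 = 1" by (simp add: E_nz)
  qed
  define \<kappa> where "\<kappa> = norm \<alpha> + norm \<beta>"
  have E_bound: "norm (E z) \<le> exp (\<kappa> * (1 + norm z))" for z
  proof -
    have "Re ((\<alpha> * z + \<beta>) / 3) \<le> norm ((\<alpha> * z + \<beta>) / 3)" by (rule complex_Re_le_cmod)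
    also have "\<dots> \<le> norm (\<alpha> * z + \<beta>)" by (simp add: norm_divide)
    also have "\<dots> \<le> norm \<alpha> * norm z + norm \<beta>" using norm_triangle_ineq[of "\<alpha> * z" \<beta>] by (simp add: norm_mult)
    also have "\<dots> \<le> \<kappa> * (1 + norm z)" by (simp add: \<kappa>_def algebra_simps)
    finally show ?thesis by (simp add: E_def)
  qed
  have "\<exists>p. \<forall>z. u z = poly p z"
    by (rule u_polynomial[OF E_hol E_nz E_bound]) (use assms(4) in \<open>simp_all add: \<kappa>_def f_eq\<close>)
  then have "u z = 0" for z using u_eq_0 by blast
  then obtain d where d: "\<And>z. F z = d" "d ^ 3 * (1 + K ^ 3) = 1"
    using constant_if_u_eq_0 by blast
  have "f z = d * exp ((\<alpha> * z + \<beta>) / 3)" for z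
    using f_eq[of z] by (simp add: d(1) E_def)
  then show ?thesis
    unfolding trivial_solution_def using d(2) cube(2) by auto
qed

end
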